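(* Let $\big(\widetilde{\omega^{(n)}}\big)_{n\ge0}$ be the state sequence of the $d$-dimensional open QBN walk and $\omega^{(n)}$ the nucleus of $\widetilde{\omega^{(n)}}$, $n\ge0$. Suppose that the nucleus $\omega^{(0)}$ of the initial state $\widetilde{\omega^{(0)}}$ takes the form $$\omega^{(0)}(\mathrm{x})=\mathsf{K}\Big(\bigotimes_{j=1}^d\rho_j^{(0)}(x_j)\Big)\mathsf{K}^{-1},\qquad \mathrm{x}=(x_1,\dots,x_d)\in\mathbb{Z}^d,$$ where $\rho_1^{(0)},\dots,\rho_d^{(0)}$ are regular $1$-dimensional nucleuses on $\mathcal{H}$. For $n\ge0$, let $X_n$ be a $d$-dimensional random vector with probability distribution $$P\{X_n=\mathrm{x}\}=\mathrm{Tr}[\omega^{(n)}(\mathrm{x})],\qquad \mathrm{x}\in\mathbb{Z}^d.$$ Then $\frac{X_n}{\sqrt n}$ converges in law, as $n\to\infty$, to the $d$-dimensional standard Gauss distribution $N(\mathbf{0},I_{d\times d})$.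
   Context: Let $d\ge 2$ be a fixed integer, $\mathbb{N}=\{0,1,2,\dots\}$, $\Lambda=\{-1,+1\}$, and $\Gamma$ the set of finite subsets of $\mathbb{N}$. Bernoulli functionals. Let $\Omega$ be the set of all functions $f\colon\mathbb{N}\to\{-1,1\}$, $\zeta_n(f)=f(n)$, $\mathscr{F}$ the $\sigma$-field generated by $(\zeta_n)_{n\ge0}$, $(p_n)_{n\ge0}$ a given sequence with $0<p_n<1$, $q_n=1-p_n$, and $\mathbb{P}$ the unique probability measure on $\mathscr{F}$ with $\mathbb{P}(\zeta_{n_1}=\epsilon_1,\dots,\zeta_{n_k}=\epsilon_k)=\prod_{j=1}^k p_{n_j}^{(1+\epsilon_j)/2}(1-p_{n_j})^{(1-\epsilon_j)/2}$ for all $k\ge 1$, distinct $n_1,\dots,n_k\in\mathbb{N}$ and $\epsilon_j\in\{-1,1\}$. Put $Z_n=(\zeta_n+q_n-p_n)/(2\sqrt{p_nq_n})$, $\mathcal{H}=L^2(\Omega,\mathscr{F},\mathbb{P})$ (complex-valued), $Z_\emptyset=1$ and $Z_\sigma=\prod_{j\in\sigma}Z_j$ for nonempty $\sigma\in\Gamma$; $\{Z_\sigma\mid\sigma\in\Gamma\}$ is an orthonormal basis of $\mathcal{H}$. For $k\ge0$, $\partial_k$ is the bounded operator on $\mathcal{H}$ with $\partial_kZ_\sigma=\mathbf{1}_\sigma(k)Z_{\sigma\setminus\{k\}}$; its adjoint satisfies $\partial_k^*Z_\sigma=[1-\mathbf{1}_\sigma(k)]Z_{\sigma\cup\{k\}}$.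 Put $L_n=\frac12(\partial_n^*+\partial_n-I)$ and $R_n=\frac12(\partial_n^*+\partial_n+I)$, $I$ being the identity on $\mathcal{H}$. Operators $C_n^{(\varepsilon)}$. Fix a unitary isomorphism $\mathsf{K}\colon\mathcal{H}^{\otimes d}\to\mathcal{H}$ ($\mathcal{H}^{\otimes d}$ is the $d$-fold Hilbert space tensor product). For $n\ge0$ and $\varepsilon=(\varepsilon_1,\dots,\varepsilon_d)\in\Lambda^d$ set $C_n^{(\varepsilon)}=\mathsf{K}\big(\bigotimes_{j=1}^dB_n^{(\varepsilon_j)}\big)\mathsf{K}^{-1}$, where $B_n^{(-1)}=L_n$ and $B_n^{(+1)}=R_n$. Nucleuses and the walk. $\mathfrak{S}_+(\mathcal{H})$ is the cone of positive trace class operators on $\mathcal{H}$. A $d$-dimensional nucleus on $\mathcal{H}$ is a mapping $\omega\colon\mathbb{Z}^d\to\mathfrak{S}_+(\mathcal{H})$ with $\sum_{\mathrm{x}\in\mathbb{Z}^d}\mathrm{Tr}[\omega(\mathrm{x})]=1$; the set of all of them is $\mathscr{T}^{(d)}(\mathcal{H})$. Define $\mathfrak{J}_n^{(d)}\colon\mathscr{T}^{(d)}(\mathcal{H})\to\mathscr{T}^{(d)}(\mathcal{H})$ by $[\mathfrak{J}_n^{(d)}\omega](\mathrm{x})=\sum_{\varepsilon\in\Lambda^d}C_n^{(\varepsilon)}\omega(\mathrm{x}-\varepsilon)C_n^{(\varepsilon)}$. The state of the $d$-dimensional open QBN walk at time $n\ge0$ is the density operator $\widetilde{\omega^{(n)}}=\sum_{\mathrm{x}\in\mathbb{Z}^d}|\delta_{\mathrm{x}}\rangle\langle\delta_{\mathrm{x}}|\otimes\omega^{(n)}(\mathrm{x})$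 on $l^2(\mathbb{Z}^d)\otimes\mathcal{H}$, where $\{\delta_{\mathrm{x}}\}$ is the canonical orthonormal basis of $l^2(\mathbb{Z}^d)$ and $\omega^{(n)}\in\mathscr{T}^{(d)}(\mathcal{H})$ is called its nucleus; the evolution is $\omega^{(n+1)}=\mathfrak{J}_n^{(d)}\omega^{(n)}$, $n\ge0$. The function $\mathrm{x}\mapsto\mathrm{Tr}[\omega^{(n)}(\mathrm{x})]$ is the probability distribution of the walk at time $n$. One-dimensional objects. $\mathscr{T}(\mathcal{H})$ is the set of $1$-dimensional nucleuses, i.e. mappings $\rho\colon\mathbb{Z}\to\mathfrak{S}_+(\mathcal{H})$ with $\sum_{x\in\mathbb{Z}}\mathrm{Tr}[\rho(x)]=1$. For $n\ge0$, $\mathfrak{J}_n\colon\mathscr{T}(\mathcal{H})\to\mathscr{T}(\mathcal{H})$ is the mapping $[\mathfrak{J}_n\rho](x)=L_n\rho(x+1)L_n+R_n\rho(x-1)R_n$, $x\in\mathbb{Z}$. A $1$-dimensional nucleus $\rho$ is called regular if the sequence $(\rho^{(n)})_{n\ge0}$ defined by $\rho^{(0)}=\rho$ and $\rho^{(n+1)}=\mathfrak{J}_n\rho^{(n)}$ satisfies $\lim_{n\to\infty}\sum_{x\in\mathbb{Z}}\mathrm{e}^{\mathrm{i}tx/\sqrt n}\,\mathrm{Tr}[\rho^{(n)}(x)]=\mathrm{e}^{-t^2/2}$ for all $t\in\mathbb{R}$. *)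

theory Defs
  imports "HOL-Probability.Probability" "HOL-Library.Nonpos_Ints"
begin

section \<open>Complex Hilbert spaces\<close>

text \<open>The inner product is antilinear in the first and linear in the second argument. The real
  Hilbert space structure, and with it norm and topology, is the one given by its real part.\<close>

class complex_hilbert_space = real_inner + complete_space +
  fixes scaleC :: "complex \<Rightarrow> 'a \<Rightarrow> 'a" (infixr "*\<^sub>C" 75)
    and cinner :: "'a \<Rightarrow> 'a \<Rightarrow> complex"
  assumes scaleC_add_right: "c *\<^sub>C (x + y) = c *\<^sub>C x + c *\<^sub>C y"
    and scaleC_add_left: "(b + c) *\<^sub>C x = b *\<^sub>C x + c *\<^sub>C x"
    and scaleC_scaleC: "b *\<^sub>C (c *\<^sub>C x) = (b * c) *\<^sub>C x"
    and scaleC_of_real: "complex_of_real r *\<^sub>C x = r *\<^sub>R x"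
    and cinner_commute: "cinner x y = cnj (cinner y x)"
    and cinner_add_right: "cinner x (y + z) = cinner x y + cinner x z"
    and cinner_scaleC_right: "cinner x (c *\<^sub>C y) = c * cinner x y"
    and Re_cinner: "Re (cinner x y) = inner x y"

definition cspan :: "'a::complex_hilbert_space set \<Rightarrow> 'a set" where
  "cspan S = span {c *\<^sub>C x | c x. x \<in> S}"

definition onb :: "'a::complex_hilbert_space set \<Rightarrow> bool" where
  "onb E \<longleftrightarrow> (\<forall>e\<in>E. \<forall>f\<in>E. cinner e f = (if e = f then 1 else 0)) \<and> closure (cspan E) = UNIV"

definition clinear_op :: "('a::complex_hilbert_space \<Rightarrow> 'b::complex_hilbert_space) \<Rightarrow> bool" where
  "clinear_op A \<longleftrightarrow> (\<forall>u v. A (u + v) = A u + A v) \<and> (\<forall>c u. A (c *\<^sub>C u) = c *\<^sub>C A u)"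

definition bounded_op :: "('a::complex_hilbert_space \<Rightarrow> 'b::complex_hilbert_space) \<Rightarrow> bool" where
  "bounded_op A \<longleftrightarrow> clinear_op A \<and> (\<exists>C. \<forall>u. norm (A u) \<le> C * norm u)"

definition is_adjoint :: "('a::complex_hilbert_space \<Rightarrow> 'a) \<Rightarrow> ('a \<Rightarrow> 'a) \<Rightarrow> bool" where
  "is_adjoint A A' \<longleftrightarrow> bounded_op A' \<and> (\<forall>u v. cinner (A' u) v = cinner u (A v))"

definition unitary_iso :: "('a::complex_hilbert_space \<Rightarrow> 'b::complex_hilbert_space) \<Rightarrow> bool" where
  "unitary_iso K \<longleftrightarrow> clinear_op K \<and> bij K \<and> (\<forall>u v. cinner (K u) (K v) = cinner u v)"

definition positive_op :: "('a::complex_hilbert_space \<Rightarrow> 'a) \<Rightarrow> bool" where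
  "positive_op A \<longleftrightarrow> bounded_op A \<and> (\<forall>u. cinner u (A u) \<in> \<real>\<^sub>\<ge>\<^sub>0)"

text \<open>\<open>B = |A|\<close>, the positive square root of \<open>A\<^sup>* A\<close>; as \<open>B\<close> is self-adjoint, \<open>B\<^sup>2 = A\<^sup>* A\<close> is the
  stated identity of forms.\<close>

definition is_abs_op :: "('a::complex_hilbert_space \<Rightarrow> 'a) \<Rightarrow> ('a \<Rightarrow> 'a) \<Rightarrow> bool" where
  "is_abs_op A B \<longleftrightarrow> positive_op B \<and> (\<forall>u v. cinner (B u) (B v) = cinner (A u) (A v))"

definition trace_class :: "('a::complex_hilbert_space \<Rightarrow> 'a) \<Rightarrow> bool" where
  "trace_class A \<longleftrightarrow> bounded_op A \<and>
     (\<exists>B E. is_abs_op A B \<and> onb E \<and> (\<lambda>e. cinner e (B e)) summable_on E)"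

definition op_trace :: "('a::complex_hilbert_space \<Rightarrow> 'a) \<Rightarrow> complex" where
  "op_trace A = (\<Sum>\<^sub>\<infinity>e\<in>(SOME E. onb E). cinner e (A e))"

definition ketbra :: "'a::complex_hilbert_space \<Rightarrow> 'a \<Rightarrow> 'a" where
  "ketbra e u = cinner e u *\<^sub>C e"

section \<open>Hilbert space tensor products\<close>

text \<open>Hilbert space tensor products are given by their characterization, unique up to a unitary
  isomorphism: a Hilbert space with a multilinear map \<open>\<tau>\<close>, sending a family of vectors to its
  elementary tensor, such that inner products of elementary tensors are products of inner products
  and the elementary tensors are total.\<close>

definition hilbert_tensor_power ::
  "(('d::finite \<Rightarrow> 'a::complex_hilbert_space) \<Rightarrow> 't::complex_hilbert_space) \<Rightarrow> bool" where
  "hilbert_tensor_power \<tau> \<longleftrightarrow>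
     (\<forall>u j a b. \<tau> (u(j := a + b)) = \<tau> (u(j := a)) + \<tau> (u(j := b))) \<and>
     (\<forall>u j c a. \<tau> (u(j := c *\<^sub>C a)) = c *\<^sub>C \<tau> (u(j := a))) \<and>
     (\<forall>u v. cinner (\<tau> u) (\<tau> v) = (\<Prod>j\<in>UNIV. cinner (u j) (v j))) \<and>
     closure (cspan (range \<tau>)) = UNIV"

text \<open>\<open>W\<close> is the operator \<open>\<Otimes>\<^sub>j A\<^sub>j\<close>.\<close>

definition is_tensor_op ::
  "(('d::finite \<Rightarrow> 'a::complex_hilbert_space) \<Rightarrow> 't::complex_hilbert_space) \<Rightarrow>
   ('d \<Rightarrow> 'a \<Rightarrow> 'a) \<Rightarrow> ('t \<Rightarrow> 't) \<Rightarrow> bool" where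
  "is_tensor_op \<tau> A W \<longleftrightarrow> bounded_op W \<and> (\<forall>u. W (\<tau> u) = \<tau> (\<lambda>j. A j (u j)))"

definition hilbert_tensor2 ::
  "('a::complex_hilbert_space \<Rightarrow> 'b::complex_hilbert_space \<Rightarrow> 't::complex_hilbert_space) \<Rightarrow> bool" where
  "hilbert_tensor2 \<tau> \<longleftrightarrow>
     (\<forall>u. clinear_op (\<tau> u)) \<and> (\<forall>v. clinear_op (\<lambda>u. \<tau> u v)) \<and>
     (\<forall>u v u' v'. cinner (\<tau> u v) (\<tau> u' v') = cinner u u' * cinner v v') \<and>
     closure (cspan {\<tau> u v | u v. True}) = UNIV"

definition is_tensor2_op ::
  "('a::complex_hilbert_space \<Rightarrow> 'b::complex_hilbert_space \<Rightarrow> 't::complex_hilbert_space) \<Rightarrow>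
   ('a \<Rightarrow> 'a) \<Rightarrow> ('b \<Rightarrow> 'b) \<Rightarrow> ('t \<Rightarrow> 't) \<Rightarrow> bool" where
  "is_tensor2_op \<tau> A B W \<longleftrightarrow> bounded_op W \<and> (\<forall>u v. W (\<tau> u v) = \<tau> (A u) (B v))"

section \<open>The space of square integrable functions\<close>

definition square_integrable :: "'w measure \<Rightarrow> ('w \<Rightarrow> complex) \<Rightarrow> bool" where
  "square_integrable M f \<longleftrightarrow> f \<in> borel_measurable M \<and> integrable M (\<lambda>w. (cmod (f w))\<^sup>2)"

text \<open>The type \<open>'a\<close> is the space \<open>L\<^sup>2(M)\<close>, and \<open>cls f\<close> is the element of it given by the square
  integrable function \<open>f\<close>. (The measure is a term, so \<open>L\<^sup>2(M)\<close> cannot be a type constructed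
  from it.) The isometry condition makes \<open>cls\<close> identify exactly the functions that agree
  almost everywhere. Nothing is said about \<open>cls\<close> on other functions.\<close>

definition is_L2 :: "'w measure \<Rightarrow> (('w \<Rightarrow> complex) \<Rightarrow> 'a::complex_hilbert_space) \<Rightarrow> bool" where
  "is_L2 M cls \<longleftrightarrow>
     (\<forall>f g. square_integrable M f \<longrightarrow> square_integrable M g \<longrightarrow>
        cls (\<lambda>w. f w + g w) = cls f + cls g \<and>
        cinner (cls f) (cls g) = (LINT w|M. cnj (f w) * g w)) \<and>
     (\<forall>c f. square_integrable M f \<longrightarrow> cls (\<lambda>w. c * f w) = c *\<^sub>C cls f) \<and>
     cls ` {f. square_integrable M f} = UNIV"

section \<open>Bernoulli functionals\<close>

definition Omega :: "(nat \<Rightarrow> int) set" where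
  "Omega = {f. \<forall>n. f n \<in> {-1, 1}}"

definition bernoulli_measure :: "(nat \<Rightarrow> real) \<Rightarrow> (nat \<Rightarrow> int) measure \<Rightarrow> bool" where
  "bernoulli_measure p P \<longleftrightarrow>
     prob_space P \<and> space P = Omega \<and>
     sets P = sigma_sets Omega {{f \<in> Omega. f n \<in> A} | n A. True} \<and>
     (\<forall>J e. finite J \<and> J \<noteq> {} \<and> (\<forall>j\<in>J. e j \<in> {-1, 1}) \<longrightarrow>
        measure P {f \<in> Omega. \<forall>j\<in>J. f j = e j} =
          (\<Prod>j\<in>J. p j powr ((1 + real_of_int (e j)) / 2) *
                   (1 - p j) powr ((1 - real_of_int (e j)) / 2)))"

definition Z1 :: "(nat \<Rightarrow> real) \<Rightarrow> nat \<Rightarrow> (nat \<Rightarrow> int) \<Rightarrow> real" where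
  "Z1 p n f = (real_of_int (f n) + (1 - p n) - p n) / (2 * sqrt (p n * (1 - p n)))"

definition Z :: "(nat \<Rightarrow> real) \<Rightarrow> nat set \<Rightarrow> (nat \<Rightarrow> int) \<Rightarrow> complex" where
  "Z p \<sigma> f = (\<Prod>j\<in>\<sigma>. complex_of_real (Z1 p j f))"

definition is_annihilation ::
  "(nat \<Rightarrow> real) \<Rightarrow> (((nat \<Rightarrow> int) \<Rightarrow> complex) \<Rightarrow> 'h::complex_hilbert_space) \<Rightarrow>
   nat \<Rightarrow> ('h \<Rightarrow> 'h) \<Rightarrow> bool" where
  "is_annihilation p cls k D \<longleftrightarrow> bounded_op D \<and>
     (\<forall>\<sigma>. finite \<sigma> \<longrightarrow> D (cls (Z p \<sigma>)) = (if k \<in> \<sigma> then cls (Z p (\<sigma> - {k})) else 0))"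

text \<open>In what follows \<open>D n\<close> stands for \<open>\<partial>\<^sub>n\<close> and \<open>D' n\<close> for its adjoint.\<close>

definition L_op :: "(nat \<Rightarrow> 'h \<Rightarrow> 'h) \<Rightarrow> (nat \<Rightarrow> 'h \<Rightarrow> 'h) \<Rightarrow> nat \<Rightarrow> 'h::complex_hilbert_space \<Rightarrow> 'h" where
  "L_op D D' n u = (1/2) *\<^sub>R (D' n u + D n u - u)"

definition R_op :: "(nat \<Rightarrow> 'h \<Rightarrow> 'h) \<Rightarrow> (nat \<Rightarrow> 'h \<Rightarrow> 'h) \<Rightarrow> nat \<Rightarrow> 'h::complex_hilbert_space \<Rightarrow> 'h" where
  "R_op D D' n u = (1/2) *\<^sub>R (D' n u + D n u + u)"

definition B_op ::
  "(nat \<Rightarrow> 'h \<Rightarrow> 'h) \<Rightarrow> (nat \<Rightarrow> 'h \<Rightarrow> 'h) \<Rightarrow> nat \<Rightarrow> int \<Rightarrow> 'h::complex_hilbert_space \<Rightarrow> 'h" where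
  "B_op D D' n s = (if s = -1 then L_op D D' n else R_op D D' n)"

section \<open>Nucleuses and the walk\<close>

text \<open>The index type \<open>'x\<close> is \<open>int\<close> or \<open>int ^ 'd\<close>.\<close>

definition nucleus :: "('x \<Rightarrow> 'h::complex_hilbert_space \<Rightarrow> 'h) \<Rightarrow> bool" where
  "nucleus \<omega> \<longleftrightarrow> (\<forall>x. positive_op (\<omega> x) \<and> trace_class (\<omega> x)) \<and>
     ((\<lambda>x. op_trace (\<omega> x)) has_sum 1) UNIV"

definition step1 ::
  "('h::complex_hilbert_space \<Rightarrow> 'h) \<Rightarrow> ('h \<Rightarrow> 'h) \<Rightarrow> (int \<Rightarrow> 'h \<Rightarrow> 'h) \<Rightarrow> int \<Rightarrow> 'h \<Rightarrow> 'h" where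
  "step1 L R \<rho> x u = L (\<rho> (x + 1) (L u)) + R (\<rho> (x - 1) (R u))"

primrec iter1 ::
  "(nat \<Rightarrow> 'h \<Rightarrow> 'h) \<Rightarrow> (nat \<Rightarrow> 'h \<Rightarrow> 'h) \<Rightarrow> (int \<Rightarrow> 'h \<Rightarrow> 'h) \<Rightarrow> nat \<Rightarrow>
   int \<Rightarrow> 'h::complex_hilbert_space \<Rightarrow> 'h" where
  "iter1 D D' \<rho> 0 = \<rho>"
| "iter1 D D' \<rho> (Suc n) = step1 (L_op D D' n) (R_op D D' n) (iter1 D D' \<rho> n)"

definition regular_nucleus ::
  "(nat \<Rightarrow> 'h \<Rightarrow> 'h) \<Rightarrow> (nat \<Rightarrow> 'h \<Rightarrow> 'h) \<Rightarrow>
   (int \<Rightarrow> 'h::complex_hilbert_space \<Rightarrow> 'h) \<Rightarrow> bool" where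
  "regular_nucleus D D' \<rho> \<longleftrightarrow> nucleus \<rho> \<and>
     (\<forall>t::real. (\<lambda>n. \<Sum>\<^sub>\<infinity>x\<in>UNIV. exp (\<i> * complex_of_real (t * real_of_int x / sqrt (real n))) *
                       op_trace (iter1 D D' \<rho> n x))
        \<longlonglongrightarrow> complex_of_real (exp (- t\<^sup>2 / 2)))"

definition Lambda :: "(int ^ 'd::finite) set" where
  "Lambda = {\<epsilon>. \<forall>j. \<epsilon> $ j \<in> {-1, 1}}"

definition step ::
  "(int ^ 'd \<Rightarrow> 'h::complex_hilbert_space \<Rightarrow> 'h) \<Rightarrow> (int ^ 'd::finite \<Rightarrow> 'h \<Rightarrow> 'h) \<Rightarrow>
   int ^ 'd \<Rightarrow> 'h \<Rightarrow> 'h" where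
  "step C \<omega> x u = (\<Sum>\<epsilon>\<in>Lambda. C \<epsilon> (\<omega> (x - \<epsilon>) (C \<epsilon> u)))"

text \<open>\<open>A = K (\<Otimes>\<^sub>j A\<^sub>j) K\<^sup>-\<^sup>1\<close>.\<close>

definition is_conj_tensor ::
  "(('d::finite \<Rightarrow> 'h::complex_hilbert_space) \<Rightarrow> 't::complex_hilbert_space) \<Rightarrow> ('t \<Rightarrow> 'h) \<Rightarrow>
   ('d \<Rightarrow> 'h \<Rightarrow> 'h) \<Rightarrow> ('h \<Rightarrow> 'h) \<Rightarrow> bool" where
  "is_conj_tensor \<tau> K As A \<longleftrightarrow> (\<exists>W. is_tensor_op \<tau> As W \<and> A = K \<circ> W \<circ> inv K)"

text \<open>The operator \<open>S\<close> on the tensor product of \<open>l\<^sup>2(\<int>\<^sup>d)\<close> and \<open>H\<close> is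
  \<open>\<Sum>\<^sub>x |\<delta>\<^sub>x\<rangle>\<langle>\<delta>\<^sub>x| \<otimes> \<omega>(x)\<close>, the series being taken pointwise. Here \<open>l\<^sup>2\<close> is \<open>L\<^sup>2\<close>
  of the counting measure, \<open>cls\<close> is its class map, so that \<open>cls (indicator {x})\<close> is \<open>\<delta>\<^sub>x\<close>,
  and \<open>\<tau>\<close> is the map forming elementary tensors.\<close>

definition is_state_with_nucleus ::
  "((int ^ 'd::finite \<Rightarrow> complex) \<Rightarrow> 'l::complex_hilbert_space) \<Rightarrow>
   ('l \<Rightarrow> 'h::complex_hilbert_space \<Rightarrow> 's::complex_hilbert_space) \<Rightarrow>
   (int ^ 'd \<Rightarrow> 'h \<Rightarrow> 'h) \<Rightarrow> ('s \<Rightarrow> 's) \<Rightarrow> bool" where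
  "is_state_with_nucleus cls \<tau> \<omega> S \<longleftrightarrow> nucleus \<omega> \<and> bounded_op S \<and>
     (\<exists>T. (\<forall>x. is_tensor2_op \<tau> (ketbra (cls (indicator {x}))) (\<omega> x) (T x)) \<and>
          (\<forall>v. ((\<lambda>x. T x v) has_sum S v) UNIV))"

section \<open>Convergence in law\<close>

definition real_vec :: "int ^ 'd \<Rightarrow> real ^ 'd::finite" where
  "real_vec x = (\<chi> j. real_of_int (x $ j))"

definition std_gauss :: "(real ^ 'd::finite) measure" where
  "std_gauss = density lborel
     (\<lambda>x. ennreal (exp (- (norm x)\<^sup>2 / 2) / (sqrt (2 * pi)) ^ CARD('d)))"

definition converges_in_law ::
  "(nat \<Rightarrow> 'w measure) \<Rightarrow> (nat \<Rightarrow> 'w \<Rightarrow> 'b::metric_space) \<Rightarrow> 'b measure \<Rightarrow> bool" where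
  "converges_in_law M X N \<longleftrightarrow>
     (\<forall>f::'b \<Rightarrow> real. continuous_on UNIV f \<and> bounded (range f) \<longrightarrow>
        (\<lambda>n. LINT w|M n. f (X n w)) \<longlonglongrightarrow> (LINT x|N. f x))"

end

theory Submission
  imports Defs
begin

text \<open>
  Everything factorizes over the coordinates. The nucleus of the walk starts as a tensor product of
  one-dimensional nucleuses, and a step sums over all sign vectors \<open>\<epsilon>\<close> a tensor product whose
  \<open>j\<close>-th factor depends on \<open>\<epsilon>\<^sub>j\<close> only. By multilinearity this is a tensor product of sums over
  single signs, so the nucleus at time \<open>n\<close> is the tensor product of the one-dimensional
  nucleuses at time \<open>n\<close> (\<open>walk_factorizes\<close>). The trace of a tensor product is the product of the
  traces (\<open>op_trace_conj_tensor\<close>), hence the law of \<open>X\<^sub>n\<close> is a product of weights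
  \<open>r n j\<close> on the integers, and regularity says that the Fourier transforms of these weights,
  scaled by \<open>\<surd>n\<close>, converge to that of the standard normal law. What remains is a central limit
  theorem for product laws (\<open>product_lattice_clt\<close>).

  On the operator side, the point is that the trace, which \<open>op_trace\<close> evaluates in one arbitrarily
  chosen orthonormal basis, can be evaluated in the basis of elementary tensors. For a positive
  operator \<open>A\<close> independence of the basis follows from finite rank compressions \<open>P A P\<close>: these
  have the same trace in every basis by the Parseval identity, and \<open>P\<close> tends to the identity
  strongly (\<open>compression_trace\<close>, \<open>trace_le\<close>). The convention that a divergent sum is \<open>0\<close> is
  compatible with these identities, also with the product formula (\<open>infsum_prod_nonneg\<close>), so
  they hold for all positive operators.

  On the probability side, the one-dimensional continuity theorem of Levy gives weak convergence
  of each marginal law. To pass to the product, represent each marginal sequence by Skorohod as a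
  pointwise convergent sequence on a space of its own; on the product of these spaces the random
  vectors converge pointwise, and bounded continuous functions of them converge in the mean by
  dominated convergence (\<open>product_weak_conv\<close>).
\<close>

section \<open>Geometry of complex Hilbert spaces\<close>

lemma cinner_add_left:
  fixes x y z :: "'a::complex_hilbert_space"
  shows "cinner (x + y) z = cinner x z + cinner y z"
  by (metis cinner_add_right cinner_commute complex_cnj_add)

lemma cinner_scaleC_left:
  fixes x y :: "'a::complex_hilbert_space"
  shows "cinner (c *\<^sub>C x) y = cnj c * cinner x y"
  by (metis cinner_commute cinner_scaleC_right complex_cnj_mult)

lemma cinner_scaleR_right:
  fixes x y :: "'a::complex_hilbert_space"
  shows "cinner x (r *\<^sub>R y) = r *\<^sub>R cinner x y"
  by (metis cinner_scaleC_right scaleC_of_real scaleR_conv_of_real)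

lemma cinner_self:
  fixes x :: "'a::complex_hilbert_space"
  shows "cinner x x = complex_of_real ((norm x)\<^sup>2)"
proof -
  have "Im (cinner x x) = 0"
    using arg_cong[OF cinner_commute[of x x], of Im] by simp
  then show ?thesis
    by (simp add: complex_eq_iff Re_cinner power2_norm_eq_inner)
qed

lemma norm_scaleC:
  fixes x :: "'a::complex_hilbert_space"
  shows "norm (c *\<^sub>C x) = cmod c * norm x"
proof -
  have "cinner (c *\<^sub>C x) (c *\<^sub>C x) = (c * cnj c) * cinner x x"
    by (simp add: cinner_scaleC_left cinner_scaleC_right)
  then have "(norm (c *\<^sub>C x))\<^sup>2 = (cmod c * norm x)\<^sup>2"
    unfolding cinner_self complex_norm_square[symmetric] of_real_mult[symmetric] of_real_eq_iff
    by (simp add: power_mult_distrib)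
  then show ?thesis
    by (metis norm_ge_zero mult_nonneg_nonneg power2_eq_iff_nonneg)
qed

text \<open>The real inequality, applied after a rotation of \<open>y\<close> that makes the inner product real.\<close>

lemma norm_cinner_le:
  fixes x y :: "'a::complex_hilbert_space"
  shows "cmod (cinner x y) \<le> norm x * norm y"
proof -
  obtain c where c: "cmod c = 1" "c * cinner x y = complex_of_real (cmod (cinner x y))"
  proof (cases "cinner x y = 0")
    case True
    then show ?thesis using that[of 1] by simp
  next
    case False
    then show ?thesis
      using that[of "cmod (cinner x y) / cinner x y"] by (simp add: norm_divide)
  qed
  have "cmod (cinner x y) = Re (cinner x (c *\<^sub>C y))"
    using c(2) by (simp add: cinner_scaleC_right)
  also have "\<dots> \<le> norm x * norm (c *\<^sub>C y)"
    unfolding Re_cinner by (rule norm_cauchy_schwarz)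
  finally show ?thesis by (simp add: norm_scaleC c(1))
qed

lemma bounded_linear_cinner_right:
  "bounded_linear (cinner (x::'a::complex_hilbert_space))"
  by (rule bounded_linear_intro[where K = "norm x"])
     (auto simp: cinner_add_right cinner_scaleR_right norm_cinner_le mult.commute[of _ "norm x"])

lemma cinner_scaleR_left:
  fixes x y :: "'a::complex_hilbert_space"
  shows "cinner (r *\<^sub>R x) y = r *\<^sub>R cinner x y"
  by (metis cinner_scaleC_left complex_cnj_complex_of_real scaleC_of_real scaleR_conv_of_real)

lemma bounded_bilinear_cinner:
  "bounded_bilinear (cinner :: 'a::complex_hilbert_space \<Rightarrow> 'a \<Rightarrow> complex)"
  by standard
     (auto simp: cinner_add_right cinner_add_left cinner_scaleR_right cinner_scaleR_left
        intro!: exI[of _ 1] norm_cinner_le)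

lemmas cinner_simps = cinner_add_left cinner_add_right cinner_scaleC_left cinner_scaleC_right
  bounded_bilinear.sum_left[OF bounded_bilinear_cinner]
  bounded_bilinear.sum_right[OF bounded_bilinear_cinner]
  bounded_bilinear.diff_left[OF bounded_bilinear_cinner]
  bounded_bilinear.diff_right[OF bounded_bilinear_cinner]
  bounded_bilinear.zero_left[OF bounded_bilinear_cinner]
  bounded_bilinear.zero_right[OF bounded_bilinear_cinner]

lemma scaleC_zero_left [simp]: "0 *\<^sub>C (x::'a::complex_hilbert_space) = 0"
  using scaleC_of_real[of 0 x] by simp

lemma scaleC_one [simp]: "1 *\<^sub>C (x::'a::complex_hilbert_space) = x"
  using scaleC_of_real[of 1 x] by simp

lemma scaleC_scaleR_commute:
  fixes x :: "'a::complex_hilbert_space"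
  shows "c *\<^sub>C (r *\<^sub>R x) = r *\<^sub>R (c *\<^sub>C x)"
  by (metis mult.commute scaleC_of_real scaleC_scaleC)

lemma bounded_linear_scaleC_right: "bounded_linear (\<lambda>x::'a::complex_hilbert_space. c *\<^sub>C x)"
  by (rule bounded_linear_intro[where K = "cmod c"])
     (auto simp: scaleC_add_right scaleC_scaleR_commute norm_scaleC mult.commute)

lemma bounded_op_imp_bounded_linear:
  assumes "bounded_op A"
  shows "bounded_linear A"
proof -
  obtain C where "\<And>u. norm (A u) \<le> C * norm u"
    using assms by (auto simp: bounded_op_def)
  then show ?thesis
    using assms
    by (intro bounded_linear_intro[where K = C])
       (auto simp: bounded_op_def clinear_op_def scaleC_of_real[symmetric] mult.commute)
qed

text \<open>Statements on all vectors are reduced to basis vectors in this form. Complex multiples appear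
  because \<open>subspace\<close> refers to the real structure.\<close>

lemma total_set_induct:
  assumes "closure (cspan S) = UNIV" and "subspace V" and "closed V"
    and "\<And>c x. x \<in> S \<Longrightarrow> c *\<^sub>C x \<in> V"
  shows "V = UNIV"
proof -
  have "cspan S \<subseteq> V"
    unfolding cspan_def using assms(2,4) by (intro span_minimal) auto
  then have "closure (cspan S) \<subseteq> V"
    using assms(3) by (rule closure_minimal)
  then show ?thesis using assms(1) by auto
qed

section \<open>Orthonormal bases and the trace of a positive operator\<close>

lemma onb_cinner: "onb E \<Longrightarrow> e \<in> E \<Longrightarrow> f \<in> E \<Longrightarrow> cinner e f = (if e = f then 1 else 0)"
  by (auto simp: onb_def)

definition proj :: "'a::complex_hilbert_space set \<Rightarrow> 'a \<Rightarrow> 'a" where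
  "proj E x = (\<Sum>e\<in>E. cinner e x *\<^sub>C e)"

lemma proj_add: "proj E (x + y) = proj E x + proj E y"
  by (simp add: proj_def cinner_simps scaleC_add_left sum.distrib)

lemma proj_diff: "proj E (x - y) = proj E x - proj E y"
  by (metis proj_add add_diff_cancel diff_add_cancel)

text \<open>By Pythagoras, as \<open>P x\<close> is orthogonal to \<open>x - P x\<close>.\<close>

lemma norm_diff_proj_le:
  assumes "onb E" "finite F" "F \<subseteq> E"
  shows "norm (x - proj F x) \<le> norm x"
proof -
  have e: "cinner e (proj F x) = cinner e x" if "e \<in> F" for e
  proof -
    have "cinner e (proj F x) = (\<Sum>f\<in>F. if e = f then cinner e x else 0)"
      unfolding proj_def cinner_simps using assms that
      by (intro sum.cong refl) (auto simp: onb_cinner subset_iff)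
    then show ?thesis using assms(2) that by simp
  qed
  have "cinner (proj F x) (x - proj F x) = (\<Sum>f\<in>F. cinner x f * (cinner f x - cinner f (proj F x)))"
    unfolding proj_def[of F x] sum_distrib_left[symmetric]
    by (subst bounded_bilinear.sum_left[OF bounded_bilinear_cinner], rule sum.cong[OF refl])
       (auto simp: cinner_scaleC_left cinner_commute[symmetric] proj_def right_diff_distrib
          bounded_bilinear.diff_right[OF bounded_bilinear_cinner])
  also have "\<dots> = 0" by (auto simp: e intro!: sum.neutral)
  finally have "inner (proj F x) (x - proj F x) = 0"
    by (metis Re_cinner zero_complex.simps(1))
  then have "(norm x)\<^sup>2 = (norm (proj F x))\<^sup>2 + (norm (x - proj F x))\<^sup>2"
    using norm_add_Pythagorean[of "proj F x" "x - proj F x"] by (simp add: orthogonal_def)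
  then have "(norm (x - proj F x))\<^sup>2 \<le> (norm x)\<^sup>2" by simp
  then show ?thesis by (rule power2_le_imp_le) simp
qed

text \<open>The vectors with a convergent expansion form a subspace that contains the basis. It is closed
  because \<open>I - P\<close> is a contraction for each projection \<open>P\<close> onto finitely many basis vectors,
  uniformly in \<open>P\<close>.\<close>

lemma onb_expansion:
  assumes E: "onb E"
  shows "((\<lambda>e. cinner e x *\<^sub>C e) has_sum x) E"
proof -
  define V where "V = {x. ((\<lambda>e. cinner e x *\<^sub>C e) has_sum x) E}"
  have V: "x \<in> V \<longleftrightarrow> ((\<lambda>F. proj F x) \<longlongrightarrow> x) (finite_subsets_at_top E)" for x
    by (simp add: V_def has_sum_def proj_def)
  have "V = UNIV"
  proof (rule total_set_induct)
    show "closure (cspan E) = UNIV" using E by (simp add: onb_def)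
    show "subspace V"
    proof (rule subspaceI)
      show "0 \<in> V" by (simp add: V_def cinner_simps)
      show "x + y \<in> V" if "x \<in> V" "y \<in> V" for x y
        using that unfolding V by (auto simp: proj_add intro: tendsto_add)
      show "r *\<^sub>R x \<in> V" if "x \<in> V" for r x
        using has_sum_scaleR[of _ E x r] that unfolding V_def
        by (simp add: cinner_scaleR_right scaleR_conv_of_real scaleC_scaleC[symmetric] scaleC_of_real)
    qed
    show "c *\<^sub>C e \<in> V" if "e \<in> E" for c e
      unfolding V_def mem_Collect_eq using E that
      by (intro has_sum_finite_neutralI[of "{e}"])
         (auto simp: cinner_simps onb_cinner)
    show "closed V"
      unfolding closed_sequential_limits
    proof (intro allI impI)
      fix s l assume s: "(\<forall>n. s n \<in> V) \<and> s \<longlonglongrightarrow> l"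
      show "l \<in> V"
        unfolding V
      proof (rule tendstoI)
        fix r :: real assume "r > 0"
        then obtain n where n: "dist (s n) l < r / 2"
          using s by (metis LIMSEQ_iff_nz half_gt_zero order_refl)
        have "\<forall>\<^sub>F F in finite_subsets_at_top E. dist (proj F (s n)) (s n) < r / 2"
          using s V[of "s n"] \<open>r > 0\<close> by (intro tendstoD[where l = "s n"]) auto
        moreover have "\<forall>\<^sub>F F in finite_subsets_at_top E. finite F \<and> F \<subseteq> E"
          by (auto simp: eventually_finite_subsets_at_top)
        ultimately show "\<forall>\<^sub>F F in finite_subsets_at_top E. dist (proj F l) l < r"
        proof eventually_elim
          case (elim F)
          \<comment> \<open>\<open>l - P l = (l - s\<^sub>n) - P (l - s\<^sub>n) + (s\<^sub>n - P s\<^sub>n)\<close>: the first two terms are small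
            because \<open>s\<^sub>n\<close> is close to \<open>l\<close>, the last one because \<open>s\<^sub>n\<close> has an expansion.\<close>
          have "dist (proj F l) l = norm (((l - s n) - proj F (l - s n)) + (s n - proj F (s n)))"
            by (simp add: proj_diff dist_norm norm_minus_commute)
          also have "\<dots> \<le> norm (l - s n) + norm (s n - proj F (s n))"
            using norm_diff_proj_le[OF E, of F "l - s n"] elim
            by (intro order.trans[OF norm_triangle_ineq]) auto
          also have "\<dots> < r"
            using n elim by (auto simp: dist_norm norm_minus_commute)
          finally show ?case .
        qed
      qed
    qed
  qed
  then show ?thesis by (auto simp: V_def)
qed

lemma onb_parseval:
  assumes "onb E"
  shows "((\<lambda>e. cinner x e * cinner e y) has_sum cinner x y) E"
  using has_sum_bounded_linear[OF bounded_linear_cinner_right[of x] onb_expansion[OF assms, of y]]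
  by (simp add: cinner_scaleC_right mult.commute o_def)

lemma has_sum_sum_finite:
  fixes f :: "'b \<Rightarrow> 'c \<Rightarrow> 'a::topological_comm_monoid_add"
  assumes "finite I" "\<And>i. i \<in> I \<Longrightarrow> (f i has_sum s i) A"
  shows "((\<lambda>x. \<Sum>i\<in>I. f i x) has_sum (\<Sum>i\<in>I. s i)) A"
  using assms by (induction I rule: finite_induct) (auto intro!: has_sum_add)

text \<open>The trace of the finite rank compression \<open>P A P\<close> can be read off in any basis: expand
  both entries of the form and sum \<open>\<langle>e', f\<rangle>\<langle>f, e\<rangle>\<close> over \<open>f\<close> by the Parseval identity.\<close>

lemma compression_trace:
  assumes E: "onb E" and F: "onb F" and E': "finite E'" "E' \<subseteq> E" and A: "bounded_op A"
  shows "((\<lambda>f. cinner (proj E' f) (A (proj E' f))) has_sum (\<Sum>e\<in>E'. cinner e (A e))) F"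
proof -
  interpret A: bounded_linear A by (rule bounded_op_imp_bounded_linear[OF A])
  have A_scaleC: "A (c *\<^sub>C u) = c *\<^sub>C A u" for c u
    using A by (simp add: bounded_op_def clinear_op_def)
  have eq: "cinner (proj E' f) (A (proj E' f)) =
      (\<Sum>e\<in>E'. \<Sum>e'\<in>E'. cinner e (A e') * (cinner e' f * cinner f e))" for f
    unfolding proj_def A.sum A_scaleC cinner_simps sum_distrib_left cinner_commute[of f, symmetric]
    by (subst sum.swap)
       (auto intro!: sum.cong simp: cinner_commute[symmetric] mult_ac)
  have "((\<lambda>f. cinner (proj E' f) (A (proj E' f))) has_sum
      (\<Sum>e\<in>E'. \<Sum>e'\<in>E'. cinner e (A e') * cinner e' e)) F"
    unfolding eq using E'(1) by (intro has_sum_sum_finite has_sum_cmult_right onb_parseval F) auto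
  also have "(\<Sum>e\<in>E'. \<Sum>e'\<in>E'. cinner e (A e') * cinner e' e) = (\<Sum>e\<in>E'. cinner e (A e))"
  proof (rule sum.cong[OF refl])
    fix e assume "e \<in> E'"
    then have "(\<Sum>e'\<in>E'. cinner e (A e') * cinner e' e) = (\<Sum>e'\<in>E'. if e' = e then cinner e (A e) else 0)"
      using E E' by (intro sum.cong refl) (auto simp: onb_cinner subset_iff)
    then show "(\<Sum>e'\<in>E'. cinner e (A e') * cinner e' e) = cinner e (A e)"
      using E' \<open>e \<in> E'\<close> by simp
  qed
  finally show ?thesis .
qed

lemma positive_op_Re_nonneg: "positive_op A \<Longrightarrow> 0 \<le> Re (cinner u (A u))"
  by (auto simp: positive_op_def complex_nonneg_Reals_iff)

lemma positive_op_of_real: "positive_op A \<Longrightarrow> cinner u (A u) = complex_of_real (Re (cinner u (A u)))"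
  by (auto simp: positive_op_def complex_nonneg_Reals_iff complex_eq_iff)

lemma positive_op_bounded: "positive_op A \<Longrightarrow> bounded_op A"
  by (simp add: positive_op_def)

text \<open>For finitely many \<open>f\<close> the sum of \<open>\<langle>f, A f\<rangle>\<close> is the limit of the sums of
  \<open>\<langle>P f, A P f\<rangle>\<close> as \<open>P\<close> grows along the finite subsets of \<open>E\<close>. Each of these is at most the
  trace of \<open>P A P\<close>, a partial sum of the trace of \<open>A\<close> in the basis \<open>E\<close>.\<close>

lemma trace_le:
  assumes E: "onb E" and F: "onb F" and A: "positive_op A"
    and sum: "(\<lambda>e. Re (cinner e (A e))) summable_on E"
  shows "(\<lambda>f. Re (cinner f (A f))) summable_on F"
    and "(\<Sum>\<^sub>\<infinity>f\<in>F. Re (cinner f (A f))) \<le> (\<Sum>\<^sub>\<infinity>e\<in>E. Re (cinner e (A e)))"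
proof -
  let ?s = "\<Sum>\<^sub>\<infinity>e\<in>E. Re (cinner e (A e))"
  note nonneg = positive_op_Re_nonneg[OF A]
  note bl = bounded_op_imp_bounded_linear[OF positive_op_bounded[OF A]]
  have le: "(\<Sum>f\<in>F'. Re (cinner f (A f))) \<le> ?s" if F': "finite F'" "F' \<subseteq> F" for F'
  proof (rule tendsto_upperbound)
    show "((\<lambda>E'. \<Sum>f\<in>F'. Re (cinner (proj E' f) (A (proj E' f)))) \<longlongrightarrow>
        (\<Sum>f\<in>F'. Re (cinner f (A f)))) (finite_subsets_at_top E)"
    proof (intro tendsto_sum tendsto_Re bounded_bilinear.tendsto[OF bounded_bilinear_cinner]
        bounded_linear.tendsto[OF bl])
      fix f
      show "((\<lambda>E'. proj E' f) \<longlongrightarrow> f) (finite_subsets_at_top E)"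
        using onb_expansion[OF E, of f] by (simp add: has_sum_def proj_def)
      then show "((\<lambda>E'. proj E' f) \<longlongrightarrow> f) (finite_subsets_at_top E)" .
    qed
    have "\<forall>\<^sub>F E' in finite_subsets_at_top E. finite E' \<and> E' \<subseteq> E"
      by (auto simp: eventually_finite_subsets_at_top)
    then show "\<forall>\<^sub>F E' in finite_subsets_at_top E.
        (\<Sum>f\<in>F'. Re (cinner (proj E' f) (A (proj E' f)))) \<le> ?s"
    proof eventually_elim
      case (elim E')
      have "((\<lambda>f. Re (cinner (proj E' f) (A (proj E' f)))) has_sum (\<Sum>e\<in>E'. Re (cinner e (A e)))) F"
        using has_sum_bounded_linear[OF bounded_linear_Re
            compression_trace[OF E F _ _ positive_op_bounded[OF A], of E']] elim
        by (simp add: o_def)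
      then have "(\<Sum>f\<in>F'. Re (cinner (proj E' f) (A (proj E' f)))) \<le> (\<Sum>e\<in>E'. Re (cinner e (A e)))"
        unfolding has_sum_iff
        using finite_sum_le_infsum[OF _ F', of "\<lambda>f. Re (cinner (proj E' f) (A (proj E' f)))"] nonneg
        by simp
      also have "\<dots> \<le> ?s"
        using elim nonneg by (intro finite_sum_le_infsum sum) auto
      finally show ?case .
    qed
  qed simp
  show "(\<lambda>f. Re (cinner f (A f))) summable_on F"
    by (rule nonneg_bdd_above_summable_on) (auto simp: nonneg intro!: bdd_aboveI[of _ ?s] le)
  then show "(\<Sum>\<^sub>\<infinity>f\<in>F. Re (cinner f (A f))) \<le> ?s"
    by (rule infsum_le_finite_sums) (auto intro: le)
qed

lemma infsum_complex_of_real: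
  "(\<Sum>\<^sub>\<infinity>x\<in>A. complex_of_real (f x)) = complex_of_real (\<Sum>\<^sub>\<infinity>x\<in>A. f x)"
proof (cases "f summable_on A")
  case True
  then show ?thesis by (intro infsumI has_sum_of_real) simp
next
  case False
  then have "\<not> (\<lambda>x. complex_of_real (f x)) summable_on A"
    using summable_on_bounded_linear[OF bounded_linear_Re, of "\<lambda>x. complex_of_real (f x)" A]
    by (auto simp: o_def)
  with False show ?thesis by (simp add: infsum_not_exists)
qed

text \<open>If the sum diverges in one basis, it diverges in every basis, and both sides have the default
  value \<open>0\<close>. So on positive operators \<open>op_trace\<close> can be evaluated in every basis.\<close>

lemma op_trace_positive:
  assumes E: "onb E" and A: "positive_op A"
  shows "op_trace A = complex_of_real (\<Sum>\<^sub>\<infinity>e\<in>E. Re (cinner e (A e)))"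
proof -
  define F where "F = (SOME E::'a set. onb E)"
  have F: "onb F" unfolding F_def using E by (rule someI)
  have "op_trace A = (\<Sum>\<^sub>\<infinity>e\<in>F. complex_of_real (Re (cinner e (A e))))"
    unfolding op_trace_def F_def[symmetric] using positive_op_of_real[OF A] by (intro infsum_cong) auto
  also have "\<dots> = complex_of_real (\<Sum>\<^sub>\<infinity>e\<in>F. Re (cinner e (A e)))"
    by (rule infsum_complex_of_real)
  also have "(\<Sum>\<^sub>\<infinity>e\<in>F. Re (cinner e (A e))) = (\<Sum>\<^sub>\<infinity>e\<in>E. Re (cinner e (A e)))"
  proof (cases "(\<lambda>e. Re (cinner e (A e))) summable_on E")
    case True
    then show ?thesis
      using trace_le[OF E F A] trace_le[OF F E A] by (intro antisym) auto
  next
    case False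
    then have "\<not> (\<lambda>e. Re (cinner e (A e))) summable_on F"
      using trace_le(1)[OF F E A] by auto
    with False show ?thesis by (simp add: infsum_not_exists)
  qed
  finally show ?thesis .
qed


section \<open>Sums of products of nonnegative families\<close>

text \<open>If all families converge, this is Fubini. If the \<open>i\<close>-th one diverges, the right-hand side
  has a factor with the default value \<open>0\<close>. Then so is the left-hand side: either another family
  vanishes and all products are \<open>0\<close>, or the left-hand side diverges, because fixing the other
  arguments at points where their families are nonzero leaves a nonzero multiple of the \<open>i\<close>-th
  family.\<close>

lemma infsum_prod_nonneg:
  fixes f :: "'i::finite \<Rightarrow> 'b \<Rightarrow> real"
  assumes nonneg: "\<And>j e. e \<in> E \<Longrightarrow> 0 \<le> f j e"
  shows "(\<Sum>\<^sub>\<infinity>g\<in>PiE UNIV (\<lambda>_. E). \<Prod>j\<in>UNIV. f j (g j)) = (\<Prod>j\<in>UNIV. \<Sum>\<^sub>\<infinity>e\<in>E. f j e)"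
    (is "infsum ?f ?P = _")
proof (cases "\<forall>j. f j summable_on E")
  case True
  then have "(\<lambda>e. norm (f j e)) summable_on E" for j
    using nonneg by (simp cong: summable_on_cong)
  then show ?thesis by (intro infsum_prod_PiE_abs) auto
next
  case False
  then obtain i where i: "\<not> f i summable_on E" by auto
  then have "(\<Prod>j\<in>UNIV. \<Sum>\<^sub>\<infinity>e\<in>E. f j e) = 0"
    by (intro prod_zero bexI[of _ i]) (auto simp: infsum_not_exists)
  moreover have "infsum ?f ?P = 0"
  proof (cases "\<exists>j. \<forall>e\<in>E. f j e = 0")
    case True
    then obtain j where "\<forall>e\<in>E. f j e = 0" by auto
    then have "?f g = 0" if "g \<in> ?P" for g
      using that by (intro prod_zero bexI[of _ j]) auto
    then show ?thesis by (rule infsum_0)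
  next
    case False
    then have "\<forall>j. \<exists>e. e \<in> E \<and> f j e \<noteq> 0" by blast
    then obtain h where h: "\<And>j. h j \<in> E" "\<And>j. f j (h j) \<noteq> 0"
      unfolding choice_iff by blast
    have inj: "inj_on (\<lambda>e. h(i := e)) E"
      by (rule inj_onI) (metis fun_upd_same)
    have "\<not> ?f summable_on ?P"
    proof
      assume "?f summable_on ?P"
      then have "?f summable_on (\<lambda>e. h(i := e)) ` E"
        by (rule summable_on_subset_banach) (use h in auto)
      then have "(\<lambda>e. ?f (h(i := e))) summable_on E"
        unfolding summable_on_reindex[OF inj] o_def .
      also have "(\<lambda>e. ?f (h(i := e))) = (\<lambda>e. f i e * (\<Prod>j\<in>UNIV - {i}. f j (h j)))"
      proof
        fix e
        have "(\<Prod>j\<in>UNIV - {i}. f j ((h(i := e)) j)) = (\<Prod>j\<in>UNIV - {i}. f j (h j))"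
          by (rule prod.cong) auto
        then show "?f (h(i := e)) = f i e * (\<Prod>j\<in>UNIV - {i}. f j (h j))"
          by (simp add: prod.remove[of UNIV i])
      qed
      finally show False
        using i h(2) by (subst (asm) summable_on_cmult_left') auto
    qed
    then show ?thesis by (simp add: infsum_not_exists)
  qed
  ultimately show ?thesis by simp
qed

section \<open>Tensor products of operators\<close>

lemma subspace_closure_span:
  "subspace (closure (span (S :: 'a::real_normed_vector set)))"
proof (rule subspaceI)
  show "0 \<in> closure (span S)"
    using closure_subset span_zero by blast
  show "x + y \<in> closure (span S)" if x: "x \<in> closure (span S)" and y: "y \<in> closure (span S)" for x y
  proof -
    obtain s where "\<forall>n. s n \<in> span S" "s \<longlonglongrightarrow> x"
      using x unfolding closure_sequential by blast
    moreover obtain t where "\<forall>n. t n \<in> span S" "t \<longlonglongrightarrow> y"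
      using y unfolding closure_sequential by blast
    ultimately show ?thesis
      unfolding closure_sequential
      by (intro exI[of _ "\<lambda>n. s n + t n"]) (simp add: tendsto_add span_add)
  qed
  show "r *\<^sub>R x \<in> closure (span S)" if x: "x \<in> closure (span S)" for r x
  proof -
    obtain s where "\<forall>n. s n \<in> span S" "s \<longlonglongrightarrow> x"
      using x unfolding closure_sequential by blast
    then show ?thesis
      unfolding closure_sequential
      by (intro exI[of _ "\<lambda>n. r *\<^sub>R s n"]) (simp add: tendsto_scaleR span_scale)
  qed
qed

lemma tensor_cinner:
  "hilbert_tensor_power \<tau> \<Longrightarrow> cinner (\<tau> u) (\<tau> v) = (\<Prod>j\<in>UNIV. cinner (u j) (v j))"
  by (simp add: hilbert_tensor_power_def)

lemma tensor_add:
  "hilbert_tensor_power \<tau> \<Longrightarrow> \<tau> (u(j := a + b)) = \<tau> (u(j := a)) + \<tau> (u(j := b))"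
  unfolding hilbert_tensor_power_def by blast

lemma tensor_scaleC:
  "hilbert_tensor_power \<tau> \<Longrightarrow> \<tau> (u(j := c *\<^sub>C a)) = c *\<^sub>C \<tau> (u(j := a))"
  unfolding hilbert_tensor_power_def by blast

text \<open>Elementary tensors depend continuously on each slot, because the norm is multiplicative on them.\<close>

lemma tensor_upd_bounded_linear:
  fixes \<tau> :: "('d::finite \<Rightarrow> 'h::complex_hilbert_space) \<Rightarrow> 't::complex_hilbert_space"
  assumes \<tau>: "hilbert_tensor_power \<tau>"
  shows "bounded_linear (\<lambda>a. \<tau> (u(j := a)))"
proof (rule bounded_linear_intro)
  show "\<tau> (u(j := a + b)) = \<tau> (u(j := a)) + \<tau> (u(j := b))" for a b
    by (rule tensor_add[OF \<tau>])
  show "\<tau> (u(j := r *\<^sub>R a)) = r *\<^sub>R \<tau> (u(j := a))" for r a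
    unfolding scaleC_of_real[symmetric] by (rule tensor_scaleC[OF \<tau>])
  show "norm (\<tau> (u(j := a))) \<le> norm a * (\<Prod>k\<in>UNIV - {j}. norm (u k))" for a
  proof -
    have "complex_of_real ((norm (\<tau> (u(j := a))))\<^sup>2)
        = complex_of_real (\<Prod>k\<in>UNIV. (norm ((u(j := a)) k))\<^sup>2)"
      unfolding cinner_self[symmetric] tensor_cinner[OF \<tau>] of_real_prod ..
    then have "(norm (\<tau> (u(j := a))))\<^sup>2 = (\<Prod>k\<in>UNIV. (norm ((u(j := a)) k))\<^sup>2)"
      using of_real_eq_iff by blast
    also have "\<dots> = (norm a * (\<Prod>k\<in>UNIV - {j}. norm (u k)))\<^sup>2"
      by (subst prod.remove[of UNIV j]) (auto simp: power_mult_distrib prod_power_distrib intro!: prod.cong)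
    finally have eq: "(norm (\<tau> (u(j := a))))\<^sup>2 = (norm a * (\<Prod>k\<in>UNIV - {j}. norm (u k)))\<^sup>2" .
    show ?thesis
      by (rule power2_le_imp_le) (simp_all add: eq prod_nonneg)
  qed
qed

text \<open>Slot by slot, an arbitrary vector is replaced by basis vectors: by multilinearity and
  continuity this does not leave the closed span.\<close>

lemma onb_tensor:
  fixes \<tau> :: "('d::finite \<Rightarrow> 'h::complex_hilbert_space) \<Rightarrow> 't::complex_hilbert_space"
    and K :: "'t \<Rightarrow> 'k::complex_hilbert_space"
  assumes E: "onb E" and \<tau>: "hilbert_tensor_power \<tau>" and K: "unitary_iso K"
  shows "onb ((\<lambda>g. K (\<tau> g)) ` PiE UNIV (\<lambda>_. E))"
    and "inj_on (\<lambda>g. K (\<tau> g)) (PiE UNIV (\<lambda>_. E))"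
proof -
  let ?P = "PiE UNIV (\<lambda>_. E) :: ('d \<Rightarrow> 'h) set"
  let ?F = "(\<lambda>g. K (\<tau> g)) ` ?P"
  have orth: "cinner (K (\<tau> g)) (K (\<tau> h)) = (if g = h then 1 else 0)" if "g \<in> ?P" "h \<in> ?P" for g h
  proof -
    have "cinner (K (\<tau> g)) (K (\<tau> h)) = (\<Prod>j\<in>UNIV. cinner (g j) (h j))"
      using K by (simp add: unitary_iso_def tensor_cinner[OF \<tau>])
    also have "\<dots> = (\<Prod>j\<in>UNIV. if g j = h j then 1 else 0)"
      by (rule prod.cong[OF refl], rule onb_cinner[OF E]) (use that in auto)
    also have "\<dots> = (if g = h then 1 else 0)"
      by (auto simp: fun_eq_iff intro!: prod_zero)
    finally show ?thesis .
  qed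
  show inj: "inj_on (\<lambda>g. K (\<tau> g)) ?P"
  proof (rule inj_onI)
    fix g h assume "g \<in> ?P" "h \<in> ?P" "K (\<tau> g) = K (\<tau> h)"
    then have "(1::complex) = (if g = h then 1 else 0)"
      using orth[of g g] orth[of g h] by simp
    then show "g = h" by (simp split: if_splits)
  qed
  have K_add: "K (u + v) = K u + K v" and K_scaleC: "K (c *\<^sub>C u) = c *\<^sub>C K u"
    and K_inner: "cinner (K u) (K v) = cinner u v" and "bij K" for u v c
    using K by (auto simp: unitary_iso_def clinear_op_def)
  have "norm (K u) = norm u" for u
    using K_inner[of u u] unfolding cinner_self of_real_eq_iff by simp
  then have "bounded_linear K"
    by (intro bounded_linear_intro[where K = 1])
       (auto simp: K_add scaleC_of_real[symmetric] K_scaleC)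
  define V where "V = closure (cspan ?F)"
  have "subspace V" "closed V"
    unfolding V_def cspan_def by (simp_all add: subspace_closure_span)
  have V_basis: "c *\<^sub>C K (\<tau> g) \<in> V" if "g \<in> ?P" for c g
    unfolding V_def cspan_def
    by (intro subsetD[OF closure_subset] span_base) (use that in blast)
  \<comment> \<open>The slots in \<open>J\<close> are the ones where arbitrary vectors are already allowed.\<close>
  have V_slots: "\<forall>u c. (\<forall>j. j \<notin> J \<longrightarrow> u j \<in> E) \<longrightarrow> c *\<^sub>C K (\<tau> u) \<in> V" if "finite J" for J
    using that
  proof (induction J rule: finite_induct)
    case empty
    then show ?case using V_basis by auto
  next
    case (insert j J)
    show ?case
    proof (intro allI impI)
      fix u :: "'d \<Rightarrow> 'h" and c assume u: "\<forall>k. k \<notin> insert j J \<longrightarrow> u k \<in> E"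
      define L where "L a = c *\<^sub>C K (\<tau> (u(j := a)))" for a
      have L: "bounded_linear L"
        unfolding L_def
        by (intro bounded_linear_compose[OF bounded_linear_scaleC_right]
            bounded_linear_compose[OF \<open>bounded_linear K\<close>] tensor_upd_bounded_linear[OF \<tau>])
      have "{a. L a \<in> V} = UNIV"
      proof (rule total_set_induct)
        show "closure (cspan E) = UNIV" using E by (simp add: onb_def)
        show "subspace {a. L a \<in> V}"
          using linear_subspace_vimage[OF bounded_linear.linear[OF L] \<open>subspace V\<close>]
          by (simp add: vimage_def)
        show "closed {a. L a \<in> V}"
          using continuous_closed_vimage[OF \<open>closed V\<close>, of L] linear_continuous_at[OF L]
          by (auto simp: vimage_def continuous_at)
        show "b *\<^sub>C e \<in> {a. L a \<in> V}" if "e \<in> E" for b e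
        proof -
          have "L (b *\<^sub>C e) = (c * b) *\<^sub>C K (\<tau> (u(j := e)))"
            by (simp add: L_def tensor_scaleC[OF \<tau>] K_scaleC scaleC_scaleC)
          moreover have "(c * b) *\<^sub>C K (\<tau> (u(j := e))) \<in> V"
            using insert.IH u that by auto
          ultimately show ?thesis by simp
        qed
      qed
      then have "L (u j) \<in> V" by auto
      then show "c *\<^sub>C K (\<tau> u) \<in> V" by (simp add: L_def)
    qed
  qed
  have "{w. K w \<in> V} = UNIV"
  proof (rule total_set_induct)
    show "closure (cspan (range \<tau>)) = UNIV" using \<tau> by (simp add: hilbert_tensor_power_def)
    show "subspace {w. K w \<in> V}"
      using linear_subspace_vimage[OF bounded_linear.linear[OF \<open>bounded_linear K\<close>] \<open>subspace V\<close>]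
      by (simp add: vimage_def)
    show "closed {w. K w \<in> V}"
      using continuous_closed_vimage[OF \<open>closed V\<close>, of K] linear_continuous_at[OF \<open>bounded_linear K\<close>]
      by (auto simp: vimage_def continuous_at)
    show "c *\<^sub>C w \<in> {w. K w \<in> V}" if "w \<in> range \<tau>" for c w
      using V_slots[of UNIV] that by (auto simp: K_scaleC)
  qed
  then have "V = UNIV"
    using bij_is_surj[OF \<open>bij K\<close>] by (metis (mono_tags, lifting) UNIV_eq_I UNIV_I mem_Collect_eq surjD)
  moreover have "\<forall>e\<in>?F. \<forall>f\<in>?F. cinner e f = (if e = f then 1 else 0)"
    using orth inj by (auto simp: inj_on_def)
  ultimately show "onb ?F"
    by (simp add: onb_def V_def)
qed

lemma Re_prod_of_real: "Re (\<Prod>j\<in>A. complex_of_real (f j)) = (\<Prod>j\<in>A. f j)"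
  by (metis Re_complex_of_real of_real_prod)

text \<open>In the basis of elementary tensors the diagonal entries of a tensor product are products
  of diagonal entries.\<close>

lemma op_trace_conj_tensor:
  fixes \<tau> :: "('d::finite \<Rightarrow> 'h::complex_hilbert_space) \<Rightarrow> 't::complex_hilbert_space"
    and K :: "'t \<Rightarrow> 'h"
  assumes E: "onb (E :: 'h set)" and \<tau>: "hilbert_tensor_power \<tau>" and K: "unitary_iso K"
    and Q: "positive_op Q" and A: "\<And>j. positive_op (A j)"
    and QA: "\<And>u. Q (K (\<tau> u)) = K (\<tau> (\<lambda>j. A j (u j)))"
  shows "op_trace Q = (\<Prod>j\<in>UNIV. op_trace (A j))"
proof -
  let ?P = "PiE UNIV (\<lambda>_. E) :: ('d \<Rightarrow> 'h) set"
  let ?F = "(\<lambda>g. K (\<tau> g)) ` ?P"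
  have "Re (cinner (K (\<tau> g)) (Q (K (\<tau> g)))) = (\<Prod>j\<in>UNIV. Re (cinner (g j) (A j (g j))))" for g
  proof -
    have "cinner (K (\<tau> g)) (Q (K (\<tau> g))) = (\<Prod>j\<in>UNIV. cinner (g j) (A j (g j)))"
      using K by (simp add: QA unitary_iso_def tensor_cinner[OF \<tau>])
    also have "\<dots> = (\<Prod>j\<in>UNIV. complex_of_real (Re (cinner (g j) (A j (g j)))))"
      using positive_op_of_real[OF A] by (intro prod.cong) auto
    finally show ?thesis by (simp only: Re_prod_of_real)
  qed
  then have "(\<Sum>\<^sub>\<infinity>f\<in>?F. Re (cinner f (Q f))) =
      (\<Sum>\<^sub>\<infinity>g\<in>?P. \<Prod>j\<in>UNIV. Re (cinner (g j) (A j (g j))))"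
    by (simp add: infsum_reindex[OF onb_tensor(2)[OF E \<tau> K]] o_def)
  also have "\<dots> = (\<Prod>j\<in>UNIV. \<Sum>\<^sub>\<infinity>e\<in>E. Re (cinner e (A j e)))"
    by (rule infsum_prod_nonneg) (rule positive_op_Re_nonneg[OF A])
  finally show ?thesis
    by (simp add: op_trace_positive[OF onb_tensor(1)[OF E \<tau> K] Q] op_trace_positive[OF E A])
qed

text \<open>Multilinear expansion; the induction expands the slots in \<open>J\<close> and leaves the others arbitrary.\<close>

lemma tensor_sum:
  fixes \<tau> :: "('d::finite \<Rightarrow> 'h::complex_hilbert_space) \<Rightarrow> 't::complex_hilbert_space"
  assumes \<tau>: "hilbert_tensor_power \<tau>" and S: "finite S"
  shows "\<tau> (\<lambda>j. \<Sum>s\<in>S. f j s) = (\<Sum>g\<in>PiE UNIV (\<lambda>_. S). \<tau> (\<lambda>j. f j (g j)))"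
proof -
  have "\<forall>u. \<tau> (\<lambda>j. if j \<in> J then \<Sum>s\<in>S. f j s else u j) =
      (\<Sum>g\<in>PiE J (\<lambda>_. S). \<tau> (\<lambda>j. if j \<in> J then f j (g j) else u j))" if "finite J" for J
    using that
  proof (induction J rule: finite_induct)
    case empty
    then show ?case by simp
  next
    case (insert i J)
    show ?case
    proof
      fix u :: "'d \<Rightarrow> 'h"
      have "\<tau> (\<lambda>j. if j \<in> insert i J then \<Sum>s\<in>S. f j s else u j) =
          \<tau> ((\<lambda>j. if j \<in> J then \<Sum>s\<in>S. f j s else u j)(i := \<Sum>s\<in>S. f i s))"
        using insert.hyps by (intro arg_cong[of _ _ \<tau>]) auto
      also have "\<dots> = (\<Sum>s\<in>S. \<tau> ((\<lambda>j. if j \<in> J then \<Sum>s\<in>S. f j s else u j)(i := f i s)))"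
        by (rule linear_sum[OF bounded_linear.linear[OF tensor_upd_bounded_linear[OF \<tau>]]])
      also have "\<dots> = (\<Sum>s\<in>S. \<tau> (\<lambda>j. if j \<in> J then \<Sum>s\<in>S. f j s else (u(i := f i s)) j))"
        using insert.hyps by (intro sum.cong refl arg_cong[of _ _ \<tau>]) auto
      also have "\<dots> = (\<Sum>s\<in>S. \<Sum>g\<in>PiE J (\<lambda>_. S). \<tau> (\<lambda>j. if j \<in> J then f j (g j) else (u(i := f i s)) j))"
        using insert.IH by simp
      also have "\<dots> = (\<Sum>(s, g)\<in>S \<times> PiE J (\<lambda>_. S).
          \<tau> (\<lambda>j. if j \<in> insert i J then f j ((g(i := s)) j) else u j))"
        unfolding sum.cartesian_product using insert.hyps
        by (intro sum.cong refl) (auto intro!: arg_cong[of _ _ \<tau>])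
      also have "\<dots> = (\<Sum>g\<in>PiE (insert i J) (\<lambda>_. S).
          \<tau> (\<lambda>j. if j \<in> insert i J then f j (g j) else u j))"
        unfolding PiE_insert_eq using insert.hyps
        by (subst sum.reindex[OF inj_combinator]) (auto simp: case_prod_unfold intro!: sum.cong)
      finally show "\<tau> (\<lambda>j. if j \<in> insert i J then \<Sum>s\<in>S. f j s else u j) = \<dots>" .
    qed
  qed
  from spec[OF this[of UNIV]] show ?thesis by simp
qed


section \<open>Positivity and the factorization of the walk\<close>

lemma bounded_op_iff:
  "bounded_op A \<longleftrightarrow> clinear_op A \<and> bounded_linear A"
proof
  assume "bounded_op A"
  then show "clinear_op A \<and> bounded_linear A"
    using bounded_op_imp_bounded_linear by (auto simp: bounded_op_def)
next
  assume A: "clinear_op A \<and> bounded_linear A"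
  then obtain C where "\<And>u. norm (A u) \<le> norm u * C"
    using bounded_linear.bounded by blast
  with A show "bounded_op A"
    by (auto simp: bounded_op_def mult.commute)
qed

lemma bounded_op_add: "bounded_op A \<Longrightarrow> bounded_op B \<Longrightarrow> bounded_op (\<lambda>u. A u + B u)"
  unfolding bounded_op_iff clinear_op_def by (auto simp: bounded_linear_add scaleC_add_right)

lemma bounded_op_compose: "bounded_op A \<Longrightarrow> bounded_op B \<Longrightarrow> bounded_op (\<lambda>u. A (B u))"
  unfolding bounded_op_iff clinear_op_def by (auto intro: bounded_linear_compose)

lemma positive_op_add:
  assumes "positive_op A" "positive_op B"
  shows "positive_op (\<lambda>u. A u + B u)"
  using assms unfolding positive_op_def
  by (auto simp: cinner_add_right bounded_op_add nonneg_Reals_add_I)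

text \<open>\<open>\<langle>u, B A B u\<rangle> = \<langle>B u, A B u\<rangle>\<close> for symmetric \<open>B\<close>.\<close>

lemma positive_op_sandwich:
  assumes "positive_op A" "bounded_op B" "\<And>u v. cinner (B u) v = cinner u (B v)"
  shows "positive_op (\<lambda>u. B (A (B u)))"
proof -
  have "bounded_op (\<lambda>u. B (A (B u)))"
    using assms(2) bounded_op_compose[OF positive_op_bounded[OF assms(1)] assms(2)]
    by (rule bounded_op_compose)
  moreover have "cinner u (B (A (B u))) = cinner (B u) (A (B u))" for u
    by (simp add: assms(3))
  ultimately show ?thesis
    using assms(1) by (simp add: positive_op_def)
qed

lemma B_op_bounded_symmetric:
  assumes D: "bounded_op (D n)" and D': "is_adjoint (D n) (D' n)"
  shows "bounded_op (B_op D D' n s)"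
    and "cinner (B_op D D' n s u) v = cinner u (B_op D D' n s v)"
proof -
  \<comment> \<open>\<open>c\<close> is the sign of the identity in \<open>L\<close> and \<open>R\<close>, so that both are treated at once.\<close>
  define c :: real where "c = (if s = -1 then -1 else 1)"
  have B: "B_op D D' n s = (\<lambda>u. (1/2) *\<^sub>R (D' n u + D n u + c *\<^sub>R u))"
    by (auto simp: B_op_def L_op_def R_op_def c_def fun_eq_iff)
  have scale: "bounded_op (\<lambda>u::'a. r *\<^sub>R u)" for r
    by (simp add: bounded_op_iff clinear_op_def scaleR_add_right scaleC_scaleR_commute
        bounded_linear_scaleR_right)
  have "bounded_op (D' n)"
    using D' by (simp add: is_adjoint_def)
  from bounded_op_compose[OF scale[of "1/2"]
      bounded_op_add[OF bounded_op_add[OF this D] scale[of c]]]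
  show "bounded_op (B_op D D' n s)"
    unfolding B .
  have 1: "cinner (D' n u) v = cinner u (D n v)" for u v
    using D' by (auto simp: is_adjoint_def)
  then have "cinner (D n u) v = cinner u (D' n v)"
    by (metis cinner_commute)
  with 1 show "cinner (B_op D D' n s u) v = cinner u (B_op D D' n s v)"
    unfolding B by (simp add: cinner_add_left cinner_add_right cinner_scaleR_left cinner_scaleR_right add_ac)
qed

text \<open>The one-dimensional step, written as a sum over signs to match the sum over sign vectors in the
  \<open>d\<close>-dimensional one.\<close>

lemma iter1_Suc_eq:
  "iter1 D D' \<rho> (Suc n) x u =
    (\<Sum>s\<in>{-1, 1}. B_op D D' n s (iter1 D D' \<rho> n (x - s) (B_op D D' n s u)))"
  by (simp add: step1_def B_op_def)

lemma iter1_positive: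
  assumes D: "\<And>n. bounded_op (D n)" and D': "\<And>n. is_adjoint (D n) (D' n)"
    and \<rho>: "\<And>x. positive_op (\<rho> x)"
  shows "positive_op (iter1 D D' \<rho> n x)"
proof (induction n arbitrary: x)
  case 0
  then show ?case by (simp add: \<rho>)
next
  case (Suc n)
  have "bounded_op (B_op D D' n s)"
    and "\<And>u v. cinner (B_op D D' n s u) v = cinner u (B_op D D' n s v)" for s
    using B_op_bounded_symmetric[of D n D' s] D D' by auto
  then have summand: "positive_op (\<lambda>u. B_op D D' n s (iter1 D D' \<rho> n (x - s) (B_op D D' n s u)))" for s
    by (rule positive_op_sandwich[OF Suc])
  have *: "iter1 D D' \<rho> (Suc n) x =
      (\<lambda>u. B_op D D' n (-1) (iter1 D D' \<rho> n (x - (-1)) (B_op D D' n (-1) u)) +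
           B_op D D' n 1 (iter1 D D' \<rho> n (x - 1) (B_op D D' n 1 u)))"
    by (rule ext, subst iter1_Suc_eq) simp
  show ?case
    unfolding * by (rule positive_op_add[OF summand summand])
qed

lemma conj_tensor_apply:
  assumes "unitary_iso K" "is_conj_tensor \<tau> K As A"
  shows "A (K (\<tau> u)) = K (\<tau> (\<lambda>j. As j (u j)))"
  using assms by (auto simp: is_conj_tensor_def is_tensor_op_def unitary_iso_def bij_is_inj)

lemma bij_betw_PiE_Lambda:
  "bij_betw vec_lambda (PiE UNIV (\<lambda>_. {-1, 1})) (Lambda :: (int ^ 'd::finite) set)"
  by (rule bij_betwI[where g = vec_nth]) (auto simp: Lambda_def)

text \<open>A step of the walk sums over all sign vectors; multilinear expansion turns this into
  independent sums over the signs in each coordinate, which are the steps of the one-dimensional walks.\<close>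

lemma walk_factorizes:
  fixes \<tau> :: "('d::finite \<Rightarrow> 'h::complex_hilbert_space) \<Rightarrow> 't::complex_hilbert_space"
    and K :: "'t \<Rightarrow> 'h"
  assumes \<tau>: "hilbert_tensor_power \<tau>" and K: "unitary_iso K"
    and C: "\<And>n \<epsilon>. \<epsilon> \<in> Lambda \<Longrightarrow> is_conj_tensor \<tau> K (\<lambda>j. B_op D D' n (\<epsilon> $ j)) (C n \<epsilon>)"
    and step: "\<And>n. \<omega> (Suc n) = step (C n) (\<omega> n)"
    and init: "\<And>x. is_conj_tensor \<tau> K (\<lambda>j. \<rho> j (x $ j)) (\<omega> 0 x)"
  shows "\<omega> n x (K (\<tau> u)) = K (\<tau> (\<lambda>j. iter1 D D' (\<rho> j) n (x $ j) (u j)))"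
proof (induction n arbitrary: x u)
  case 0
  then show ?case by (simp add: conj_tensor_apply[OF K init])
next
  case (Suc n)
  have K_lin: "linear K"
    using K by (intro linearI) (auto simp: unitary_iso_def clinear_op_def scaleC_of_real[symmetric])
  let ?f = "\<lambda>j s. B_op D D' n s (iter1 D D' (\<rho> j) n (x $ j - s) (B_op D D' n s (u j)))"
  have "\<omega> (Suc n) x (K (\<tau> u)) = (\<Sum>\<epsilon>\<in>Lambda. K (\<tau> (\<lambda>j. ?f j (\<epsilon> $ j))))"
    unfolding step step_def
    by (intro sum.cong refl) (simp add: conj_tensor_apply[OF K C] Suc)
  also have "\<dots> = (\<Sum>g\<in>PiE UNIV (\<lambda>_. {-1, 1}). K (\<tau> (\<lambda>j. ?f j (g j))))"
    by (subst sum.reindex_bij_betw[OF bij_betw_PiE_Lambda, symmetric]) simp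
  also have "\<dots> = K (\<tau> (\<lambda>j. \<Sum>s\<in>{-1, 1}. ?f j s))"
    by (subst tensor_sum[OF \<tau>]) (simp_all add: linear_sum[OF K_lin])
  also have "\<dots> = K (\<tau> (\<lambda>j. iter1 D D' (\<rho> j) (Suc n) (x $ j) (u j)))"
    unfolding iter1_Suc_eq ..
  finally show ?case .
qed


section \<open>Laws on finite products\<close>

lemma measurable_vec_lambda:
  fixes f :: "'d::finite \<Rightarrow> 'w \<Rightarrow> real"
  assumes "\<And>j. f j \<in> borel_measurable M"
  shows "(\<lambda>w. \<chi> j. f j w) \<in> borel_measurable M"
  using assms by (subst borel_measurable_euclidean_space) (auto simp: Basis_vec_def inner_axis)

lemma measurable_vec_lambda_PiM:
  fixes f :: "'d::finite \<Rightarrow> 'a \<Rightarrow> real"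
  assumes "\<And>j. f j \<in> borel_measurable (M j)"
  shows "(\<lambda>x. \<chi> j. f j (x j)) \<in> borel_measurable (PiM UNIV M)"
proof (rule measurable_vec_lambda)
  fix j
  show "(\<lambda>x. f j (x j)) \<in> borel_measurable (PiM UNIV M)"
    using measurable_compose[OF measurable_component_singleton[of j UNIV M] assms[of j]] by simp
qed

lemma product_sigma_finite_prob:
  "(\<And>j. prob_space (M j)) \<Longrightarrow> product_sigma_finite M"
  by (simp add: product_sigma_finite_def prob_space_imp_sigma_finite)

lemma distr_PiM_components:
  fixes M :: "'d::finite \<Rightarrow> 'a measure" and N :: "'d \<Rightarrow> 'b measure"
  assumes M: "\<And>j. prob_space (M j)" and f: "\<And>j. f j \<in> measurable (M j) (N j)"
  shows "distr (PiM UNIV M) (PiM UNIV N) (\<lambda>x j. f j (x j)) = PiM UNIV (\<lambda>j. distr (M j) (N j) (f j))"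
proof (rule product_sigma_finite.PiM_eqI)
  show "product_sigma_finite (\<lambda>j. distr (M j) (N j) (f j))"
    by (rule product_sigma_finite_prob, rule prob_space.prob_space_distr[OF M f])
  show "finite (UNIV :: 'd set)" by simp
  show "sets (distr (PiM UNIV M) (PiM UNIV N) (\<lambda>x j. f j (x j))) =
      sets (PiM UNIV (\<lambda>j. distr (M j) (N j) (f j)))"
    by (simp cong: sets_PiM_cong)
  interpret M: product_sigma_finite M by (rule product_sigma_finite_prob[OF M])
  have meas: "(\<lambda>x j. f j (x j)) \<in> measurable (PiM UNIV M) (PiM UNIV N)"
  proof (rule measurable_PiM_single')
    show "(\<lambda>x. f j (x j)) \<in> measurable (PiM UNIV M) (N j)" for j
      using measurable_compose[OF measurable_component_singleton[of j UNIV M] f[of j]] by simp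
    show "(\<lambda>x j. f j (x j)) \<in> space (PiM UNIV M) \<rightarrow> PiE UNIV (\<lambda>j. space (N j))"
      using measurable_space[OF f] by (simp add: space_PiM PiE_UNIV_domain Pi_iff)
  qed
  fix A :: "'d \<Rightarrow> 'b set"
  assume "\<And>j. j \<in> UNIV \<Longrightarrow> A j \<in> sets (distr (M j) (N j) (f j))"
  then have A: "A j \<in> sets (N j)" for j by simp
  have "(\<lambda>x j. f j (x j)) -` PiE UNIV A \<inter> space (PiM UNIV M) = PiE UNIV (\<lambda>j. f j -` A j \<inter> space (M j))"
    by (auto simp: space_PiM PiE_UNIV_domain Pi_iff)
  then show "emeasure (distr (PiM UNIV M) (PiM UNIV N) (\<lambda>x j. f j (x j))) (PiE UNIV A) =
      (\<Prod>j\<in>UNIV. emeasure (distr (M j) (N j) (f j)) (A j))"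
    using A meas by (simp add: emeasure_distr sets_PiM_I_finite f M.emeasure_PiM measurable_sets[OF f])
qed

lemma lborel_vec_eq_product:
  "(lborel :: (real ^ 'd::finite) measure) = distr (PiM UNIV (\<lambda>_. lborel)) borel vec_lambda"
proof (rule lborel_eqI)
  interpret product_sigma_finite "\<lambda>_::'d. lborel :: real measure"
    by (simp add: product_sigma_finite_def sigma_finite_lborel)
  have meas: "vec_lambda \<in> borel_measurable (PiM UNIV (\<lambda>_::'d. lborel :: real measure))"
    using measurable_vec_lambda_PiM[of "\<lambda>_ x. x" "\<lambda>_. lborel"] by simp
  fix l u :: "real ^ 'd"
  assume lu: "\<And>b. b \<in> Basis \<Longrightarrow> l \<bullet> b \<le> u \<bullet> b"
  have le: "l $ j \<le> u $ j" for j
    using lu[of "axis j 1"] by (auto simp: Basis_vec_def inner_axis)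
  have "vec_lambda -` box l u \<inter> space (PiM UNIV (\<lambda>_::'d. lborel :: real measure)) =
      PiE UNIV (\<lambda>j. {l $ j <..< u $ j})"
    by (auto simp: space_PiM mem_box_cart PiE_UNIV_domain Pi_iff)
  then have "emeasure (distr (PiM UNIV (\<lambda>_::'d. lborel)) borel vec_lambda) (box l u) =
      (\<Prod>j\<in>UNIV. ennreal (u $ j - l $ j))"
    using meas le by (simp add: emeasure_distr emeasure_PiM)
  also have "\<dots> = ennreal (\<Prod>j\<in>UNIV. (u - l) \<bullet> axis j 1)"
    using le by (subst prod_ennreal) (auto simp: inner_axis)
  also have "(\<Prod>j\<in>UNIV. (u - l) \<bullet> axis j 1) = (\<Prod>b\<in>Basis. (u - l) \<bullet> b)"
    by (simp add: Basis_vec_def UNION_singleton_eq_range axis_eq_axis inj_on_def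
        prod.reindex[of "\<lambda>j. axis j (1::real)" UNIV "\<lambda>b. (u - l) \<bullet> b", unfolded o_def])
  finally show "emeasure (distr (PiM UNIV (\<lambda>_::'d. lborel)) borel vec_lambda) (box l u) =
      ennreal (\<Prod>b\<in>Basis. (u - l) \<bullet> b)" .
qed simp

text \<open>The Gauss density is the product of the one-dimensional ones since
  \<open>(norm x)\<^sup>2\<close> is the sum of the squared coordinates.\<close>

lemma std_gauss_eq_product:
  "(std_gauss :: (real ^ 'd::finite) measure) =
    distr (PiM UNIV (\<lambda>_. std_normal_distribution)) borel vec_lambda"
proof -
  let ?L = "PiM UNIV (\<lambda>_::'d. lborel :: real measure)"
  let ?g = "\<lambda>x::real ^ 'd. ennreal (exp (- (norm x)\<^sup>2 / 2) / (sqrt (2 * pi)) ^ CARD('d))"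
  interpret L: product_sigma_finite "\<lambda>_::'d. lborel :: real measure"
    by (simp add: product_sigma_finite_def sigma_finite_lborel)
  have meas: "vec_lambda \<in> borel_measurable ?L"
    using measurable_vec_lambda_PiM[of "\<lambda>_ x. x" "\<lambda>_. lborel"] by simp
  have g: "?g (vec_lambda x) = (\<Prod>j\<in>UNIV. ennreal (std_normal_density (x j)))" for x :: "'d \<Rightarrow> real"
  proof -
    have "(\<Prod>j\<in>UNIV. ennreal (std_normal_density (x j))) = ennreal (\<Prod>j\<in>UNIV. std_normal_density (x j))"
      by (rule prod_ennreal) simp
    also have "(\<Prod>j\<in>UNIV. std_normal_density (x j)) =
        exp (\<Sum>j\<in>UNIV. - (x j)\<^sup>2 / 2) / (sqrt (2 * pi)) ^ CARD('d)"
      by (simp add: std_normal_density_def prod_dividef exp_sum power_divide)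
    also have "(\<Sum>j\<in>UNIV. - (x j)\<^sup>2 / 2) = - (\<Sum>j\<in>UNIV. (x j)\<^sup>2) / 2"
      by (simp add: sum_negf sum_divide_distrib)
    also have "(\<Sum>j\<in>UNIV. (x j)\<^sup>2) = (norm (vec_lambda x))\<^sup>2"
      by (simp add: norm_vec_def L2_set_def sum_nonneg)
    finally show ?thesis by simp
  qed
  have "density ?L (\<lambda>x. ?g (vec_lambda x)) = PiM UNIV (\<lambda>_::'d. std_normal_distribution)"
  proof (rule product_sigma_finite.PiM_eqI)
    show "product_sigma_finite (\<lambda>_::'d. std_normal_distribution)"
      using real_dist_normal_dist by (intro product_sigma_finite_prob) (simp add: real_distribution_def)
    show "finite (UNIV :: 'd set)" by simp
    show "sets (density ?L (\<lambda>x. ?g (vec_lambda x))) = sets (PiM UNIV (\<lambda>_::'d. std_normal_distribution))"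
      by (simp cong: sets_PiM_cong)
    fix A :: "'d \<Rightarrow> real set"
    assume "\<And>j. j \<in> UNIV \<Longrightarrow> A j \<in> sets std_normal_distribution"
    then have A[measurable]: "A j \<in> sets borel" for j by simp
    have sets: "PiE UNIV A \<in> sets ?L"
      by (rule sets_PiM_I_finite) simp_all
    have "emeasure (density ?L (\<lambda>x. ?g (vec_lambda x))) (PiE UNIV A) =
        (\<integral>\<^sup>+x. (\<Prod>j\<in>UNIV. ennreal (std_normal_density (x j)) * indicator (A j) (x j)) \<partial>?L)"
      unfolding g
      by (subst emeasure_density)
         (auto intro!: nn_integral_cong sets borel_measurable_prod
           simp: prod.distrib indicator_def PiE_UNIV_domain[of A] Pi_iff
             sets[unfolded PiE_UNIV_domain] split: if_splits)
    also have "\<dots> = (\<Prod>j\<in>UNIV. \<integral>\<^sup>+x. ennreal (std_normal_density x) * indicator (A j) x \<partial>lborel)"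
      by (rule L.product_nn_integral_prod) auto
    also have "\<dots> = (\<Prod>j\<in>UNIV. emeasure std_normal_distribution (A j))"
      by (intro prod.cong refl) (simp add: emeasure_density)
    finally show "emeasure (density ?L (\<lambda>x. ?g (vec_lambda x))) (PiE UNIV A) = \<dots>" .
  qed
  moreover have "density (distr ?L borel vec_lambda) ?g =
      distr (density ?L (\<lambda>x. ?g (vec_lambda x))) borel vec_lambda"
    using meas by (intro density_distr) auto
  ultimately show ?thesis
    unfolding std_gauss_def lborel_vec_eq_product by simp
qed


section \<open>Convergence in law of vectors with independent lattice components\<close>

text \<open>Both measures have mass \<open>1\<close> on \<open>S\<close>, so every event may be intersected with \<open>S\<close>.\<close>

lemma prob_measure_eqI_countable:
  assumes "prob_space M" "prob_space N" and sets: "sets M = sets N"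
    and S: "countable S" "\<And>x. x \<in> S \<Longrightarrow> {x} \<in> sets N"
    and eq: "\<And>x. x \<in> S \<Longrightarrow> emeasure M {x} = emeasure N {x}"
    and N: "emeasure N S = 1"
  shows "M = N"
proof (rule measure_eqI[OF sets])
  interpret M: prob_space M by fact
  interpret N: prob_space N by fact
  have sub: "emeasure M A = emeasure N A" "A \<in> sets M" "A \<in> sets N" if "A \<subseteq> S" for A
  proof -
    have A: "countable A" "\<And>x. x \<in> A \<Longrightarrow> {x} \<in> sets N"
      using S that countable_subset by auto
    show "emeasure M A = emeasure N A"
      using A eq that by (auto simp: emeasure_countable_singleton sets intro!: nn_integral_cong)
    show "A \<in> sets N" using A by (rule sets.countable[rotated])
    then show "A \<in> sets M" by (simp add: sets)
  qed
  fix A assume A: "A \<in> sets M"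
  have "emeasure M A = emeasure M (A \<inter> S)"
  proof (rule emeasure_eq_AE)
    have "AE x in M. x \<in> S"
      using sub[of S] N by (subst M.AE_in_set_eq_1) (auto simp: M.emeasure_eq_measure)
    then show "AE x in M. x \<in> A \<longleftrightarrow> x \<in> A \<inter> S" by auto
  qed (use A sub[of "A \<inter> S"] in auto)
  also have "\<dots> = emeasure N (A \<inter> S)" by (rule sub) simp
  also have "\<dots> = emeasure N A"
  proof (rule emeasure_eq_AE)
    have "AE x in N. x \<in> S"
      using sub[of S] N by (subst N.AE_in_set_eq_1) (auto simp: N.emeasure_eq_measure)
    then show "AE x in N. x \<in> A \<inter> S \<longleftrightarrow> x \<in> A" by auto
  qed (use A sub[of "A \<inter> S"] sets in auto)
  finally show "emeasure M A = emeasure N A" .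
qed

text \<open>Point masses determine the law, as those of the product law already sum to \<open>1\<close>. It is then
  carried through the scaling coordinate by coordinate. For \<open>c = 0\<close>, the value of \<open>\<surd>n\<close> at the
  start of the sequence, both sides scale everything to \<open>0\<close>.\<close>

lemma lattice_vector_law:
  fixes \<nu> :: "'d::finite \<Rightarrow> int pmf" and X :: "'w \<Rightarrow> real ^ 'd"
  assumes N: "prob_space N" and X: "X \<in> borel_measurable N"
    and law: "\<And>x::int ^ 'd. measure N {w \<in> space N. X w = real_vec x} = (\<Prod>j\<in>UNIV. pmf (\<nu> j) (x $ j))"
  shows "distr N borel (\<lambda>w. X w /\<^sub>R c) =
    distr (PiM UNIV (\<lambda>j. distr (measure_pmf (\<nu> j)) borel (\<lambda>y. real_of_int y / c))) borel vec_lambda"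
proof -
  let ?Q = "PiM UNIV (\<lambda>j. measure_pmf (\<nu> j))"
  define \<phi> where "\<phi> g = (\<chi> j::'d. real_of_int (g j))" for g
  interpret N: prob_space N by fact
  interpret Q: product_prob_space "\<lambda>j. measure_pmf (\<nu> j)" UNIV by standard
  have \<phi>: "\<phi> \<in> borel_measurable ?Q"
    unfolding \<phi>_def by (rule measurable_vec_lambda_PiM) simp
  have inj: "inj \<phi>" by (auto simp: \<phi>_def inj_def vec_eq_iff fun_eq_iff)
  have "distr N borel X = distr ?Q borel \<phi>"
  proof (rule prob_measure_eqI_countable)
    show "prob_space (distr N borel X)" by (rule N.prob_space_distr[OF X])
    show "prob_space (distr ?Q borel \<phi>)" by (rule Q.prob_space_distr[OF \<phi>])
    show "countable (range \<phi>)" by simp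
    show "{x} \<in> sets (distr ?Q borel \<phi>)" for x by simp
    have "\<phi> -` range \<phi> \<inter> space ?Q = space ?Q" by auto
    moreover have "range \<phi> \<in> sets borel" using \<open>countable (range \<phi>)\<close> by (rule sets.countable[rotated]) simp
    ultimately show "emeasure (distr ?Q borel \<phi>) (range \<phi>) = 1"
      using Q.emeasure_space_1 \<phi> by (simp add: emeasure_distr)
    fix v assume "v \<in> range \<phi>"
    then obtain g where v: "v = \<phi> g" by auto
    have "emeasure (distr N borel X) {v} = ennreal (measure N {w \<in> space N. X w = real_vec (vec_lambda g)})"
      using X by (auto simp: emeasure_distr N.emeasure_eq_measure v \<phi>_def real_vec_def vimage_def Int_def conj_commute)
    also have "\<dots> = (\<Prod>j\<in>UNIV. emeasure (measure_pmf (\<nu> j)) {g j})"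
      unfolding law by (simp add: emeasure_pmf_single prod_ennreal)
    also have "\<dots> = emeasure ?Q (PiE UNIV (\<lambda>j. {g j}))"
      by (rule Q.emeasure_PiM[symmetric]) auto
    also have "PiE UNIV (\<lambda>j. {g j}) = \<phi> -` {v} \<inter> space ?Q"
      by (auto simp: v inj_eq[OF inj] space_PiM PiE_UNIV_domain Pi_iff fun_eq_iff)
    also have "emeasure ?Q (\<phi> -` {v} \<inter> space ?Q) = emeasure (distr ?Q borel \<phi>) {v}"
      using \<phi> by (simp add: emeasure_distr)
    finally show "emeasure (distr N borel X) {v} = emeasure (distr ?Q borel \<phi>) {v}" .
  qed simp
  then have "distr N borel (\<lambda>w. X w /\<^sub>R c) = distr (distr ?Q borel \<phi>) borel (\<lambda>v. v /\<^sub>R c)"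
    using distr_distr[of "\<lambda>v. v /\<^sub>R c" borel borel X N] X by (simp add: o_def)
  also have "\<dots> = distr ?Q borel (\<lambda>g. \<phi> g /\<^sub>R c)"
    using distr_distr[of "\<lambda>v. v /\<^sub>R c" borel borel \<phi> ?Q] \<phi> by (simp add: o_def)
  also have "(\<lambda>g. \<phi> g /\<^sub>R c) = vec_lambda \<circ> (\<lambda>g j. real_of_int (g j) / c)"
    by (auto simp: \<phi>_def vec_eq_iff divide_inverse mult.commute)
  also have "distr ?Q borel (vec_lambda \<circ> (\<lambda>g j. real_of_int (g j) / c)) =
      distr (distr ?Q (PiM UNIV (\<lambda>_::'d. borel)) (\<lambda>g j. real_of_int (g j) / c)) borel vec_lambda"
  proof (rule distr_distr[symmetric])
    show "vec_lambda \<in> borel_measurable (PiM UNIV (\<lambda>_::'d. borel :: real measure))"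
      using measurable_vec_lambda_PiM[of "\<lambda>_ x. x" "\<lambda>_. borel"] by simp
    show "(\<lambda>g j. real_of_int (g j) / c) \<in> measurable ?Q (PiM UNIV (\<lambda>_::'d. borel))"
    proof (rule measurable_PiM_single')
      fix j
      show "(\<lambda>g. real_of_int (g j) / c) \<in> borel_measurable ?Q"
        using measurable_compose[OF measurable_component_singleton[of j UNIV "\<lambda>j. measure_pmf (\<nu> j)"],
            of "\<lambda>y. real_of_int y / c" borel] by simp
    qed (simp add: PiE_UNIV_domain)
  qed
  also have "distr ?Q (PiM UNIV (\<lambda>_::'d. borel)) (\<lambda>g j. real_of_int (g j) / c) =
      PiM UNIV (\<lambda>j. distr (measure_pmf (\<nu> j)) borel (\<lambda>y. real_of_int y / c))"
    by (rule distr_PiM_components[of _ "\<lambda>_ y. real_of_int y / c"]) (simp_all add: measure_pmf.prob_space_axioms)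
  finally show ?thesis .
qed

text \<open>Represent each marginal sequence by Skorohod on its own probability space; on the product of
  these spaces the vectors converge pointwise, so dominated convergence applies.\<close>

lemma product_weak_conv:
  fixes \<mu> :: "'d::finite \<Rightarrow> nat \<Rightarrow> real measure" and f :: "real ^ 'd \<Rightarrow> real"
  assumes \<mu>: "\<And>j n. real_distribution (\<mu> j n)" and \<mu>': "\<And>j. real_distribution (\<mu>' j)"
    and conv: "\<And>j. weak_conv_m (\<mu> j) (\<mu>' j)"
    and f: "continuous_on UNIV f" "bounded (range f)"
  shows "(\<lambda>n. LINT v|distr (PiM UNIV (\<lambda>j. \<mu> j n)) borel vec_lambda. f v)
    \<longlonglongrightarrow> (LINT v|distr (PiM UNIV \<mu>') borel vec_lambda. f v)"
proof -
  \<comment> \<open>\<open>S\<close> collects the properties of a Skorohod representation of the \<open>j\<close>-th sequence, so that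
    the three objects can be chosen for all \<open>j\<close> together.\<close>
  define S where "S j \<Omega> Y Y' \<longleftrightarrow> prob_space \<Omega> \<and> (\<forall>n. Y n \<in> borel_measurable \<Omega>) \<and>
      (\<forall>n. distr \<Omega> borel (Y n) = \<mu> j n) \<and> Y' \<in> borel_measurable \<Omega> \<and> distr \<Omega> borel Y' = \<mu>' j \<and>
      (\<forall>x\<in>space \<Omega>. (\<lambda>n. Y n x) \<longlonglongrightarrow> Y' x)"
    for j and \<Omega> :: "real measure" and Y Y'
  have "\<forall>j. \<exists>\<Omega> Y Y'. S j \<Omega> Y Y'"
    unfolding S_def using Skorohod[OF \<mu> \<mu>' conv] by simp
  then obtain \<Omega> Y Y' where S: "\<And>j. S j (\<Omega> j) (Y j) (Y' j)"
    by metis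
  have \<Omega>: "prob_space (\<Omega> j)" and Y: "Y j n \<in> borel_measurable (\<Omega> j)" "distr (\<Omega> j) borel (Y j n) = \<mu> j n"
    and Y': "Y' j \<in> borel_measurable (\<Omega> j)" "distr (\<Omega> j) borel (Y' j) = \<mu>' j"
    and lim: "x \<in> space (\<Omega> j) \<Longrightarrow> (\<lambda>n. Y j n x) \<longlonglongrightarrow> Y' j x" for j n x
    using S[of j] by (auto simp: S_def)
  interpret P: prob_space "PiM UNIV \<Omega>" by (rule prob_space_PiM[OF \<Omega>])
  have f_meas: "f \<in> borel_measurable borel" by (rule borel_measurable_continuous_onI[OF f(1)])
  have represent: "(LINT v|distr (PiM UNIV \<eta>) borel vec_lambda. f v) = (LINT x|PiM UNIV \<Omega>. f (\<chi> j. V j (x j)))"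
    if V: "\<And>j. V j \<in> borel_measurable (\<Omega> j)" and \<eta>: "\<And>j. distr (\<Omega> j) borel (V j) = \<eta> j" for V \<eta>
  proof -
    have meas: "(\<lambda>x j. V j (x j)) \<in> measurable (PiM UNIV \<Omega>) (PiM UNIV (\<lambda>_::'d. borel))"
    proof (rule measurable_PiM_single')
      fix j
      show "(\<lambda>x. V j (x j)) \<in> borel_measurable (PiM UNIV \<Omega>)"
        using measurable_compose[OF measurable_component_singleton[of j UNIV \<Omega>] V[of j]] by simp
    qed (simp add: PiE_UNIV_domain)
    have vec: "vec_lambda \<in> borel_measurable (PiM UNIV (\<lambda>_::'d. borel :: real measure))"
      using measurable_vec_lambda_PiM[of "\<lambda>_ x. x" "\<lambda>_. borel"] by simp
    have "PiM UNIV \<eta> = distr (PiM UNIV \<Omega>) (PiM UNIV (\<lambda>_::'d. borel)) (\<lambda>x j. V j (x j))"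
      using distr_PiM_components[of \<Omega> V "\<lambda>_. borel", OF \<Omega> V] by (simp add: \<eta>)
    then have "distr (PiM UNIV \<eta>) borel vec_lambda = distr (PiM UNIV \<Omega>) borel (\<lambda>x. \<chi> j. V j (x j))"
      using distr_distr[OF vec meas] by (simp add: o_def)
    then show ?thesis
      using f_meas measurable_compose[OF meas vec] by (simp add: integral_distr)
  qed
  obtain B where B: "\<And>v. \<bar>f v\<bar> \<le> B"
    using f(2) by (auto simp: bounded_iff)
  have "(\<lambda>n. LINT x|PiM UNIV \<Omega>. f (\<chi> j. Y j n (x j))) \<longlonglongrightarrow> (LINT x|PiM UNIV \<Omega>. f (\<chi> j. Y' j (x j)))"
  proof (rule integral_dominated_convergence)
    show "(\<lambda>x. f (\<chi> j. Y' j (x j))) \<in> borel_measurable (PiM UNIV \<Omega>)"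
      by (intro measurable_compose[OF _ f_meas] measurable_vec_lambda_PiM Y')
    show "(\<lambda>x. f (\<chi> j. Y j n (x j))) \<in> borel_measurable (PiM UNIV \<Omega>)" for n
      by (intro measurable_compose[OF _ f_meas] measurable_vec_lambda_PiM Y)
    show "integrable (PiM UNIV \<Omega>) (\<lambda>_. B)" by simp
    show "AE x in PiM UNIV \<Omega>. norm (f (\<chi> j. Y j n (x j))) \<le> B" for n
      using B by simp
    show "AE x in PiM UNIV \<Omega>. (\<lambda>n. f (\<chi> j. Y j n (x j))) \<longlonglongrightarrow> f (\<chi> j. Y' j (x j))"
    proof (rule AE_I2)
      fix x assume "x \<in> space (PiM UNIV \<Omega>)"
      then have "x j \<in> space (\<Omega> j)" for j by (auto simp: space_PiM PiE_UNIV_domain)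
      then have "(\<lambda>n. \<chi> j. Y j n (x j)) \<longlonglongrightarrow> (\<chi> j. Y' j (x j))"
        by (intro tendsto_vec_lambda lim)
      then show "(\<lambda>n. f (\<chi> j. Y j n (x j))) \<longlonglongrightarrow> f (\<chi> j. Y' j (x j))"
        using f(1) by (intro isCont_tendsto_compose[of _ f]) (auto simp: continuous_on_eq_continuous_at)
    qed
  qed
  moreover have "(LINT v|distr (PiM UNIV (\<lambda>j. \<mu> j n)) borel vec_lambda. f v) =
      (LINT x|PiM UNIV \<Omega>. f (\<chi> j. Y j n (x j)))" for n
    by (rule represent) (rule Y)+
  moreover have "(LINT v|distr (PiM UNIV \<mu>') borel vec_lambda. f v) =
      (LINT x|PiM UNIV \<Omega>. f (\<chi> j. Y' j (x j)))"
    by (rule represent) (rule Y')+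
  ultimately show ?thesis by simp
qed


section \<open>A central limit theorem for product weights on the lattice\<close>

lemma pmf_of_nonneg_sum:
  fixes r :: "'a \<Rightarrow> real"
  assumes "\<And>y. 0 \<le> r y" and sum: "r summable_on UNIV" and s: "infsum r UNIV > 0"
  obtains p where "\<And>y. pmf p y = r y / infsum r UNIV"
proof
  let ?f = "\<lambda>y. r y / infsum r UNIV"
  have nonneg: "0 \<le> ?f y" for y using assms by simp
  have has_sum: "(?f has_sum 1) UNIV"
    using has_sum_cmult_left[OF has_sum_infsum[OF sum], of "inverse (infsum r UNIV)"] s
    by (simp add: divide_inverse)
  then have abs: "Infinite_Set_Sum.abs_summable_on ?f UNIV"
    unfolding abs_summable_equivalent[symmetric] real_norm_def abs_of_nonneg[OF nonneg]
    by (rule has_sum_imp_summable)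
  have "(\<integral>\<^sup>+y. ennreal (?f y) \<partial>count_space UNIV) = ennreal (infsetsum ?f UNIV)"
    by (rule nn_integral_conv_infsetsum[OF abs nonneg])
  also have "infsetsum ?f UNIV = 1"
    using infsetsum_infsum[OF abs] infsumI[OF has_sum] by simp
  finally show "pmf (embed_pmf ?f) y = ?f y" for y
    using nonneg by (intro pmf_embed_pmf) auto
qed

lemma char_distr_pmf:
  "char (distr (measure_pmf p) borel g) t =
    (\<Sum>\<^sub>\<infinity>y. exp (\<i> * complex_of_real (t * g y)) * complex_of_real (pmf p y))"
proof -
  let ?h = "\<lambda>y. pmf p y *\<^sub>R exp (\<i> * complex_of_real (t * g y))"
  have "char (distr (measure_pmf p) borel g) t =
      integral\<^sup>L (measure_pmf p) (\<lambda>y. exp (\<i> * complex_of_real (t * g y)))"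
    unfolding char_def by (rule integral_distr) auto
  also have "\<dots> = infsetsum ?h UNIV"
    unfolding infsetsum_def measure_pmf_eq_density by (subst integral_density) simp_all
  also have "\<dots> = infsum ?h UNIV"
  proof (rule infsetsum_infsum)
    have "Infinite_Set_Sum.abs_summable_on (pmf p) UNIV" by (rule pmf_abs_summable)
    then show "Infinite_Set_Sum.abs_summable_on ?h UNIV"
      by (rule abs_summable_on_comparison_test') (simp add: norm_mult)
  qed
  finally show ?thesis by (simp add: scaleR_conv_of_real mult.commute)
qed

lemma infsum_vec_prod:
  fixes r :: "'d::finite \<Rightarrow> 'a \<Rightarrow> real"
  assumes "\<And>j y. 0 \<le> r j y"
  shows "(\<Sum>\<^sub>\<infinity>x::'a ^ 'd. \<Prod>j\<in>UNIV. r j (x $ j)) = (\<Prod>j\<in>UNIV. \<Sum>\<^sub>\<infinity>y. r j y)"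
proof -
  have "bij_betw vec_lambda (PiE UNIV (\<lambda>_. UNIV)) (UNIV :: ('a ^ 'd) set)"
    by (rule bij_betwI[where g = vec_nth]) auto
  from infsum_reindex_bij_betw[OF this, of "\<lambda>x. \<Prod>j\<in>UNIV. r j (x $ j)"]
  show ?thesis using infsum_prod_nonneg[of UNIV r] assms by simp
qed

text \<open>The total masses \<open>s n j\<close> of the weights may differ from \<open>1\<close>. But their product over \<open>j\<close> is
  \<open>1\<close>, so the weights can be normalized without changing the joint law; and \<open>s n j \<longlonglongrightarrow> 1\<close> by
  the hypothesis at \<open>t = 0\<close>, so the limits of the Fourier transforms stay the same. The Levy
  continuity theorem then applies to each coordinate.\<close>

theorem product_lattice_clt:
  fixes r :: "nat \<Rightarrow> 'd::finite \<Rightarrow> int \<Rightarrow> real" and X :: "nat \<Rightarrow> 'w \<Rightarrow> real ^ 'd"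
  assumes nonneg: "\<And>n j y. 0 \<le> r n j y"
    and total: "\<And>n. (\<Sum>\<^sub>\<infinity>x::int ^ 'd. \<Prod>j\<in>UNIV. r n j (x $ j)) = 1"
    and fourier: "\<And>j t. (\<lambda>n. \<Sum>\<^sub>\<infinity>y. exp (\<i> * complex_of_real (t * real_of_int y / sqrt (real n))) *
        complex_of_real (r n j y)) \<longlonglongrightarrow> complex_of_real (exp (- t\<^sup>2 / 2))"
    and M: "\<And>n. prob_space (M n)" and X: "\<And>n. X n \<in> borel_measurable (M n)"
    and law: "\<And>n x. measure (M n) {w \<in> space (M n). X n w = real_vec x} = (\<Prod>j\<in>UNIV. r n j (x $ j))"
  shows "converges_in_law M (\<lambda>n w. X n w /\<^sub>R sqrt (real n)) std_gauss"
proof -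
  define s where "s n j = (\<Sum>\<^sub>\<infinity>y. r n j y)" for n j
  have prod_s: "(\<Prod>j\<in>UNIV. s n j) = 1" for n
    using total[of n] infsum_vec_prod[of "r n"] nonneg by (simp add: s_def)
  then have "s n j \<noteq> 0" for n j
    by (metis UNIV_I finite_class.finite_UNIV prod_zero zero_neq_one)
  moreover have "0 \<le> s n j" for n j
    unfolding s_def by (rule infsum_nonneg) (rule nonneg)
  ultimately have s_pos: "0 < s n j" for n j
    by (simp add: less_le)
  \<comment> \<open>A divergent sum would have the value \<open>0\<close>.\<close>
  have "r n j summable_on UNIV" for n j
    using s_pos[of n j] infsum_not_exists[of "r n j" UNIV] by (fastforce simp: s_def)
  then have "\<exists>p. \<forall>y. pmf p y = r n j y / s n j" for n j
    using pmf_of_nonneg_sum[of "r n j"] nonneg s_pos[of n j] unfolding s_def by metis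
  then obtain \<nu> where \<nu>: "\<And>n j y. pmf (\<nu> n j) y = r n j y / s n j"
    by metis
  define \<mu> where "\<mu> j n = distr (measure_pmf (\<nu> n j)) borel (\<lambda>y. real_of_int y / sqrt (real n))" for j n
  have \<mu>: "real_distribution (\<mu> j n)" for j n
    unfolding \<mu>_def by (rule prob_space.real_distribution_distr) (auto simp: measure_pmf.prob_space_axioms)
  define F where "F j t n = (\<Sum>\<^sub>\<infinity>y. exp (\<i> * complex_of_real (t * real_of_int y / sqrt (real n))) *
      complex_of_real (r n j y))" for j t n
  have F: "F j t \<longlonglongrightarrow> complex_of_real (exp (- t\<^sup>2 / 2))" for j t
    unfolding F_def by (rule fourier)
  have "F j 0 = (\<lambda>n. complex_of_real (s n j))" for j
    by (simp add: F_def s_def infsum_complex_of_real fun_eq_iff)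
  then have s_lim: "(\<lambda>n. complex_of_real (s n j)) \<longlonglongrightarrow> 1" for j
    using F[of j 0] by simp
  have char: "char (\<mu> j n) t = F j t n / complex_of_real (s n j)" for j n t
    unfolding \<mu>_def char_distr_pmf \<nu> F_def
    by (simp add: divide_inverse infsum_cmult_left' flip: mult.assoc)
  have "weak_conv_m (\<mu> j) std_normal_distribution" for j
  proof (rule levy_continuity[OF \<mu> real_dist_normal_dist])
    fix t
    show "(\<lambda>n. char (\<mu> j n) t) \<longlonglongrightarrow> char std_normal_distribution t"
      unfolding char char_std_normal_distribution using tendsto_divide[OF F s_lim] by simp
  qed
  note weak = product_weak_conv[of \<mu> "\<lambda>_. std_normal_distribution", OF \<mu> real_dist_normal_dist this]
  have "(\<Prod>j\<in>UNIV. pmf (\<nu> n j) (x $ j)) = (\<Prod>j\<in>UNIV. r n j (x $ j))" for n and x :: "int ^ 'd"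
    unfolding \<nu> by (simp add: prod_dividef prod_s)
  then have distr: "distr (M n) borel (\<lambda>w. X n w /\<^sub>R sqrt (real n)) =
      distr (PiM UNIV (\<lambda>j. \<mu> j n)) borel vec_lambda" for n
    unfolding \<mu>_def by (intro lattice_vector_law M X) (simp add: law)
  show ?thesis
    unfolding converges_in_law_def
  proof (intro allI impI)
    fix f :: "real ^ 'd \<Rightarrow> real"
    assume f: "continuous_on UNIV f \<and> bounded (range f)"
    then have f_meas: "f \<in> borel_measurable borel" by (intro borel_measurable_continuous_onI) auto
    have "(LINT w|M n. f (X n w /\<^sub>R sqrt (real n))) =
        (LINT v|distr (PiM UNIV (\<lambda>j. \<mu> j n)) borel vec_lambda. f v)" for n
      unfolding distr[symmetric] using X[of n] f_meas by (subst integral_distr) auto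
    then show "(\<lambda>n. LINT w|M n. f (X n w /\<^sub>R sqrt (real n))) \<longlonglongrightarrow> (LINT x|std_gauss. f x)"
      unfolding std_gauss_eq_product using weak f by simp
  qed
qed

section \<open>The open QBN walk\<close>

theorem theorem3p5:
  fixes p :: "nat \<Rightarrow> real"
    and P :: "(nat \<Rightarrow> int) measure"
    and cls :: "((nat \<Rightarrow> int) \<Rightarrow> complex) \<Rightarrow> 'h::complex_hilbert_space"
    and D D' :: "nat \<Rightarrow> 'h \<Rightarrow> 'h"
    and \<tau> :: "('d::finite \<Rightarrow> 'h) \<Rightarrow> 't::complex_hilbert_space"
    and K :: "'t \<Rightarrow> 'h"
    and C :: "nat \<Rightarrow> int ^ 'd \<Rightarrow> 'h \<Rightarrow> 'h"
    and cls_l2 :: "(int ^ 'd \<Rightarrow> complex) \<Rightarrow> 'l::complex_hilbert_space"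
    and \<tau>\<^sub>2 :: "'l \<Rightarrow> 'h \<Rightarrow> 's::complex_hilbert_space"
    and state :: "nat \<Rightarrow> 's \<Rightarrow> 's"
    and \<omega> :: "nat \<Rightarrow> int ^ 'd \<Rightarrow> 'h \<Rightarrow> 'h"
    and \<rho> :: "'d \<Rightarrow> int \<Rightarrow> 'h \<Rightarrow> 'h"
    and M :: "nat \<Rightarrow> 'w measure"
    and X :: "nat \<Rightarrow> 'w \<Rightarrow> real ^ 'd"
  assumes "CARD('d) \<ge> 2"
    and "\<And>n. 0 < p n \<and> p n < 1"
    and "bernoulli_measure p P"
    and "is_L2 P cls"
    and "\<And>n. is_annihilation p cls n (D n)"
    and "\<And>n. is_adjoint (D n) (D' n)"
    and "hilbert_tensor_power \<tau>"
    and "unitary_iso K"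
    and "\<And>n \<epsilon>. \<epsilon> \<in> Lambda \<Longrightarrow> is_conj_tensor \<tau> K (\<lambda>j. B_op D D' n (\<epsilon> $ j)) (C n \<epsilon>)"
    and "is_L2 (count_space UNIV) cls_l2"
    and "hilbert_tensor2 \<tau>\<^sub>2"
    and "\<And>n. is_state_with_nucleus cls_l2 \<tau>\<^sub>2 (\<omega> n) (state n)"
    and "\<And>n. \<omega> (Suc n) = step (C n) (\<omega> n)"
    and "\<And>j. regular_nucleus D D' (\<rho> j)"
    and "\<And>x. is_conj_tensor \<tau> K (\<lambda>j. \<rho> j (x $ j)) (\<omega> 0 x)"
    and "\<And>n. prob_space (M n)"
    and "\<And>n. X n \<in> borel_measurable (M n)"
    and "\<And>n x. complex_of_real (measure (M n) {w \<in> space (M n). X n w = real_vec x}) =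
                op_trace (\<omega> n x)"
  shows "converges_in_law M (\<lambda>n w. X n w /\<^sub>R sqrt (real n)) std_gauss"
proof -
  note D = \<open>\<And>n. is_annihilation p cls n (D n)\<close> and D' = \<open>\<And>n. is_adjoint (D n) (D' n)\<close>
    and \<tau> = \<open>hilbert_tensor_power \<tau>\<close> and K = \<open>unitary_iso K\<close>
    and C = \<open>\<And>n \<epsilon>. \<epsilon> \<in> Lambda \<Longrightarrow> is_conj_tensor \<tau> K (\<lambda>j. B_op D D' n (\<epsilon> $ j)) (C n \<epsilon>)\<close>
    and state = \<open>\<And>n. is_state_with_nucleus cls_l2 \<tau>\<^sub>2 (\<omega> n) (state n)\<close>
    and step = \<open>\<And>n. \<omega> (Suc n) = step (C n) (\<omega> n)\<close>
    and regular = \<open>\<And>j. regular_nucleus D D' (\<rho> j)\<close>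
    and init = \<open>\<And>x. is_conj_tensor \<tau> K (\<lambda>j. \<rho> j (x $ j)) (\<omega> 0 x)\<close>
    and law = \<open>\<And>n x. complex_of_real (measure (M n) {w \<in> space (M n). X n w = real_vec x}) =
      op_trace (\<omega> n x)\<close>
  let ?\<rho> = "\<lambda>n j. iter1 D D' (\<rho> j) n"
  define r where "r n j y = Re (op_trace (?\<rho> n j y))" for n j y
  have nucleus: "nucleus (\<omega> n)" for n
    using state[of n] by (simp add: is_state_with_nucleus_def)
  \<comment> \<open>The definition of trace class operators supplies an orthonormal basis.\<close>
  then obtain E :: "'h set" where E: "onb E"
    unfolding nucleus_def trace_class_def by blast
  have \<omega>_pos: "positive_op (\<omega> n x)" for n x
    using nucleus by (simp add: nucleus_def)
  have \<rho>_pos: "positive_op (?\<rho> n j y)" for n j y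
    using D D' regular by (intro iter1_positive) (auto simp: is_annihilation_def regular_nucleus_def nucleus_def)
  have r: "op_trace (?\<rho> n j y) = complex_of_real (r n j y)" for n j y
    by (simp add: r_def op_trace_positive[OF E \<rho>_pos])
  have nonneg: "0 \<le> r n j y" for n j y
    by (simp add: r_def op_trace_positive[OF E \<rho>_pos] infsum_nonneg positive_op_Re_nonneg[OF \<rho>_pos])
  have factor: "op_trace (\<omega> n x) = complex_of_real (\<Prod>j\<in>UNIV. r n j (x $ j))" for n x
  proof -
    have "op_trace (\<omega> n x) = (\<Prod>j\<in>UNIV. op_trace (?\<rho> n j (x $ j)))"
    proof (rule op_trace_conj_tensor[OF E \<tau> K \<omega>_pos])
      show "\<omega> n x (K (\<tau> u)) = K (\<tau> (\<lambda>j. ?\<rho> n j (x $ j) (u j)))" for u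
        by (rule walk_factorizes[OF \<tau> K C step init])
    qed (rule \<rho>_pos)
    then show ?thesis by (simp add: r)
  qed
  show ?thesis
  proof (rule product_lattice_clt[of r, OF nonneg])
    fix n
    show "(\<Sum>\<^sub>\<infinity>x. \<Prod>j\<in>UNIV. r n j (x $ j)) = 1"
      using nucleus[of n] infsum_complex_of_real[of "\<lambda>x. \<Prod>j\<in>UNIV. r n j (x $ j)" UNIV]
      unfolding nucleus_def factor by (simp add: has_sum_iff del: of_real_prod)
    show "measure (M n) {w \<in> space (M n). X n w = real_vec x} = (\<Prod>j\<in>UNIV. r n j (x $ j))" for x
      using law[of n x] unfolding factor of_real_eq_iff .
  next
    fix j t
    show "(\<lambda>n. \<Sum>\<^sub>\<infinity>y. exp (\<i> * complex_of_real (t * real_of_int y / sqrt (real n))) *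
        complex_of_real (r n j y)) \<longlonglongrightarrow> complex_of_real (exp (- t\<^sup>2 / 2))"
      using regular[of j] unfolding regular_nucleus_def r by simp
  qed fact+
qed

end
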